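(* Let $\mathcal{H}$ be sampled from the binary non-uniform hypergraph stochastic block model on $N$ vertices with true label vector $y$ and parameters $\alpha_\ell = a_\ell q_N/\binom{N-1}{\ell-1}$, $\beta_\ell = b_\ell q_N/\binom{N-1}{\ell-1}$ ($\ell\in\mathbb{L}$), where $1\ll q_N\lesssim \log N$ and $a_\ell\ge b_\ell\gtrsim 1$. Suppose that $$\limsup_{N\to\infty}\ \frac{\mathrm{D}_{\mathrm{GH}}\cdot q_N}{\log N}<1,\qquad \mathrm{D}_{\mathrm{GH}}=\sum_{\ell\in\mathbb{L}}\frac{1}{2^{\ell-1}}\big(\sqrt{a_\ell}-\sqrt{b_\ell}\big)^2 .$$ Then, with probability tending to $1$ as $N\to\infty$, every algorithm misclassifies at least two vertices; that is, for every sequence of estimators $\widehat y=\widehat y(\mathcal{H})\in\{\pm1\}^{V}$, $$\lim_{N\to\infty}\mathbb{P}\big(N\,\eta_N(y,\widehat y)\ge 2\big)=1 .$$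
   Context: Model. $N$ is even, $V$ is a vertex set with $|V|=N$, and $N\to\infty$. The label vector $y$ is uniform over $\{z\in\{\pm1\}^V:\sum_v z_v=0\}$. $\mathbb{L}$ is a fixed finite set of integers $\ge 2$. Conditionally on $y$, for every $\ell\in\mathbb{L}$, each $\ell$-subset $e\subset V$ is a hyperedge of $\mathcal{H}$ independently (over all $e$ and all $\ell$), with probability $\alpha_\ell$ if all vertices of $e$ have the same label and with probability $\beta_\ell$ otherwise. The numbers $a_\ell,b_\ell$ may depend on $N$; $\gtrsim 1$ means bounded below by a positive constant, $f\ll g$ means $f/g\to0$, and $f\lesssim g$ means $f=O(g)$. Mismatch ratio: $\eta_N(y,\widehat y)=\frac1N\min_{s\in\{\pm1\}}\#\{v\in V: s y_v\neq\widehat y_v\}$.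
   Formalization: The edge probabilities α_ℓ are additionally assumed to tend to 0 (automatic for bounded a_ℓ); without this the claim fails, e.g. for L={2}, q_N=log N, α=1, β=(1−d)² with d=√(log N/(N−1)), where labels are exactly recoverable although the limsup is 1/2. *)

theory Defs
  imports "HOL-Probability.Probability" "HOL-Library.Landau_Symbols"
begin

text \<open>The vertex set is \<open>V = {..<N}\<close>. A label vector is a function that is \<open>undefined\<close>
  outside \<open>V\<close>, so that the set of balanced label vectors is finite.\<close>

definition balanced_labels :: "nat \<Rightarrow> (nat \<Rightarrow> int) set" where
  "balanced_labels N = {z \<in> {..<N} \<rightarrow>\<^sub>E {-1, 1}. (\<Sum>v<N. z v) = 0}"

definition potential_edges :: "nat set \<Rightarrow> nat \<Rightarrow> nat set set" where
  "potential_edges L N = {e. e \<subseteq> {..<N} \<and> card e \<in> L}"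

definition monochromatic :: "(nat \<Rightarrow> int) \<Rightarrow> nat set \<Rightarrow> bool" where
  "monochromatic y e \<longleftrightarrow> (\<forall>u\<in>e. \<forall>v\<in>e. y u = y v)"

text \<open>Common form of \<open>\<alpha>\<^sub>\<ell>\<close> (with \<open>c = a\<^sub>\<ell>\<close>) and \<open>\<beta>\<^sub>\<ell>\<close> (with \<open>c = b\<^sub>\<ell>\<close>).\<close>

definition edge_prob :: "nat \<Rightarrow> real \<Rightarrow> nat \<Rightarrow> real \<Rightarrow> real" where
  "edge_prob N q l c = c * q / real ((N - 1) choose (l - 1))"

text \<open>A hypergraph is identified with its set of hyperedges; all coordinates of \<open>Pi_pmf\<close> are
  independent. Note that \<open>bernoulli_pmf\<close> clamps its parameter to the unit interval, so the
  definition is the intended one only when every \<open>\<alpha>\<^sub>\<ell>\<close> and \<open>\<beta>\<^sub>\<ell>\<close> lies in \<open>[0,1]\<close>.\<close>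

definition hypergraph_pmf ::
  "nat set \<Rightarrow> nat \<Rightarrow> (nat \<Rightarrow> real) \<Rightarrow> (nat \<Rightarrow> real) \<Rightarrow> (nat \<Rightarrow> int) \<Rightarrow> nat set set pmf" where
  "hypergraph_pmf L N \<alpha> \<beta> y =
     map_pmf Collect
       (Pi_pmf (potential_edges L N) False
          (\<lambda>e. bernoulli_pmf (if monochromatic y e then \<alpha> (card e) else \<beta> (card e))))"

text \<open>Joint law of \<open>(y, \<H>)\<close>.\<close>

definition hsbm ::
  "nat set \<Rightarrow> nat \<Rightarrow> (nat \<Rightarrow> real) \<Rightarrow> (nat \<Rightarrow> real) \<Rightarrow> real \<Rightarrow> ((nat \<Rightarrow> int) \<times> nat set set) pmf"
where
  "hsbm L N a b q =
     bind_pmf (pmf_of_set (balanced_labels N))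
       (\<lambda>y. map_pmf (Pair y)
          (hypergraph_pmf L N (\<lambda>l. edge_prob N q l (a l)) (\<lambda>l. edge_prob N q l (b l)) y))"

definition mismatch_ratio :: "nat \<Rightarrow> (nat \<Rightarrow> int) \<Rightarrow> (nat \<Rightarrow> int) \<Rightarrow> real" where
  "mismatch_ratio N y z =
     1 / real N * real (MIN s\<in>{-1, 1}. card {v \<in> {..<N}. s * y v \<noteq> z v})"

definition D_GH :: "nat set \<Rightarrow> (nat \<Rightarrow> real) \<Rightarrow> (nat \<Rightarrow> real) \<Rightarrow> real" where
  "D_GH L a b = (\<Sum>l\<in>L. 1 / 2 ^ (l - 1) * (sqrt (a l) - sqrt (b l))\<^sup>2)"

text \<open>The filter ``\<open>N \<rightarrow> \<infinity>\<close> along even \<open>N\<close>''.\<close>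

definition even_at_top :: "nat filter" where
  "even_at_top = inf at_top (principal {N. even N})"

end

theory Submission
  imports Defs "HOL-Real_Asymp.Real_Asymp"
begin

text \<open>
  \<^bold>\<open>Why the threshold is sharp in this direction.\<close> Call a vertex flippable if, all other labels
  being given, the hypergraph does not speak clearly against reversing its label. Swapping the
  labels of a flippable vertex \<open>u\<close> with \<open>y u = 1\<close> and a flippable vertex \<open>w\<close> with \<open>y w = -1\<close>
  produces another balanced label vector that explains the hypergraph almost as well as \<open>y\<close>
  does. If both classes contain many flippable vertices, then the posterior mass of \<open>y\<close> is
  shared with very many such swaps, and no estimator can single out \<open>y\<close>, not even up to one
  vertex.

  \<^bold>\<open>There are many flippable vertices.\<close> The likelihood ratio between a vertex and its reversal
  compares two product Bernoulli laws. Under the product law \<open>r\<close> proportional to the geometric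
  mean of the two, the log-likelihood ratio is centred, because among the edges involved the
  same number is monochromatic and non-monochromatic for each edge size, and its variance is of
  order \<open>D_GH * q\<close>, hence \<open>O(log N)\<close>. Changing measure from \<open>r\<close> costs the Bhattacharyya
  coefficient, which is about \<open>exp (- D_GH * q)\<close>, times \<open>exp (- x)\<close> for a threshold \<open>x\<close> that is
  a small multiple of \<open>log N\<close> (\<open>tilting_lower_bound\<close>, \<open>second_moment_tilted\<close>,
  \<open>flip_favoured_prob\<close>). Below the threshold this probability is at least
  \<open>N powr (-1 + 14/5 * \<epsilon>) / 2\<close>, so that about \<open>N powr (1 - \<epsilon>)\<close> vertices of each class, marked in
  advance, contain a positive power of \<open>N\<close> of flippable ones.

  \<^bold>\<open>Independence.\<close> The marked vertices form a set \<open>T\<close>. Each marked vertex is judged only by its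
  own edges, those that meet \<open>T\<close> in no other vertex; own edges of different vertices are
  disjoint, so Chebyshev's inequality applies (\<open>many_events_occur\<close>). The remaining edges that a
  swap affects contain two marked vertices. They are so few that the two laws of these edges
  have Hellinger distance \<open>o(1)\<close>, so that they cost at most a factor \<open>4\<close> for most pairs
  (\<open>likelihood_ratio_small\<close>, \<open>random_pair_survives\<close>, \<open>not_swappable_prob\<close>).

  \<^bold>\<open>Estimators that are allowed one error.\<close> An estimate that is itself unbalanced is within
  distance one of about \<open>N / 2\<close> balanced vectors. All of these arise from the estimate by
  reversing one vertex of its larger class, say the one of label \<open>\<sigma>\<close>. Fixing one flippable \<open>u\<close>
  of label \<open>\<sigma>\<close> for each of them and letting only the other vertex \<open>w\<close> vary, the results of the
  swaps coincide for at most two pairs: the swap shows \<open>w\<close>, and it shows the reversed vertex and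
  \<open>u\<close> up to their order. Hence these vectors together carry a vanishing part of the posterior
  mass (\<open>near_balanced_mass\<close>).
\<close>

section \<open>Independent random subsets\<close>

text \<open>The law of a random subset of \<open>E\<close> that contains each \<open>e\<close> independently with probability
  \<open>p e\<close>. Since every space that occurs is finite, finite sums replace integrals: changing
  \<open>p\<close> then means rewriting a product.\<close>

definition subset_weight :: "('e \<Rightarrow> real) \<Rightarrow> 'e set \<Rightarrow> 'e set \<Rightarrow> real" where
  "subset_weight p E X = (\<Prod>e\<in>E. if e \<in> X then p e else 1 - p e)"

definition subset_mean :: "('e \<Rightarrow> real) \<Rightarrow> 'e set \<Rightarrow> ('e set \<Rightarrow> real) \<Rightarrow> real" where
  "subset_mean p E f = (\<Sum>X\<in>Pow E. subset_weight p E X * f X)"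

lemma subset_weight_cong:
  assumes "\<And>e. e \<in> E \<Longrightarrow> p e = p' e" "\<And>e. e \<in> E \<Longrightarrow> e \<in> X \<longleftrightarrow> e \<in> X'"
  shows "subset_weight p E X = subset_weight p' E X'"
  unfolding subset_weight_def using assms by (intro prod.cong) auto

lemma subset_weight_Un:
  assumes "finite A" "finite B" "A \<inter> B = {}"
  shows "subset_weight p (A \<union> B) X = subset_weight p A X * subset_weight p B X"
  unfolding subset_weight_def using assms by (rule prod.union_disjoint)

lemma subset_weight_nonneg:
  assumes "\<And>e. e \<in> E \<Longrightarrow> 0 \<le> p e \<and> p e \<le> 1"
  shows "0 \<le> subset_weight p E X"
  unfolding subset_weight_def using assms by (intro prod_nonneg) auto

lemma subset_weight_pos:
  assumes "\<And>e. e \<in> E \<Longrightarrow> 0 < p e \<and> p e < 1"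
  shows "0 < subset_weight p E X"
  unfolding subset_weight_def using assms by (intro prod_pos) auto

lemma subset_mean_Un:
  assumes "finite A" "finite B" "A \<inter> B = {}"
  shows "subset_mean p (A \<union> B) f = subset_mean p A (\<lambda>X. subset_mean p B (\<lambda>Y. f (X \<union> Y)))"
proof -
  have "subset_mean p (A \<union> B) f
    = (\<Sum>(X, Y)\<in>Pow A \<times> Pow B. subset_weight p (A \<union> B) (X \<union> Y) * f (X \<union> Y))"
    unfolding subset_mean_def
    by (rule sum.reindex_bij_witness[where j = "\<lambda>Z. (Z \<inter> A, Z \<inter> B)" and i = "\<lambda>(X, Y). X \<union> Y"])
       (use assms(3) in \<open>auto simp: Int_Un_distrib[symmetric] Int_absorb2\<close>)
  also have "\<dots> = (\<Sum>(X, Y)\<in>Pow A \<times> Pow B. subset_weight p A X * (subset_weight p B Y * f (X \<union> Y)))"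
  proof (intro sum.cong refl, clarify)
    fix X Y assume XY: "X \<subseteq> A" "Y \<subseteq> B"
    have "subset_weight p A (X \<union> Y) = subset_weight p A X" "subset_weight p B (X \<union> Y)
      = subset_weight p B Y"
      by (rule subset_weight_cong; use XY assms(3) in auto)+
    then show "subset_weight p (A \<union> B) (X \<union> Y) * f (X \<union> Y)
      = subset_weight p A X * (subset_weight p B Y * f (X \<union> Y))"
      using subset_weight_Un[OF assms] by simp
  qed
  also have "\<dots> = subset_mean p A (\<lambda>X. subset_mean p B (\<lambda>Y. f (X \<union> Y)))"
    unfolding subset_mean_def by (simp add: sum.cartesian_product[symmetric] sum_distrib_left)
  finally show ?thesis .
qed

lemma subset_mean_cong:
  assumes "\<And>e. e \<in> E \<Longrightarrow> p e = p' e" "\<And>X. X \<subseteq> E \<Longrightarrow> f X = f' X"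
  shows "subset_mean p E f = subset_mean p' E f'"
  unfolding subset_mean_def using assms
    by (intro sum.cong arg_cong2[where f = "(*)"] subset_weight_cong) auto

lemma subset_mean_empty [simp]: "subset_mean p {} f = f {}"
  by (simp add: subset_mean_def subset_weight_def)

lemma subset_mean_singleton: "subset_mean p {e} f = p e * f {e} + (1 - p e) * f {}"
proof -
  have "Pow {e} = {{e}, {}}" by auto
  then show ?thesis by (simp add: subset_mean_def subset_weight_def)
qed

lemma subset_mean_insert:
  assumes "finite E" "e \<notin> E"
  shows "subset_mean p (insert e E) f
    = p e * subset_mean p E (\<lambda>X. f (insert e X)) + (1 - p e) * subset_mean p E f"
  using subset_mean_Un[of "{e}" E p f] assms by (simp add: subset_mean_singleton)

lemma subset_mean_add: "subset_mean p E (\<lambda>X. f X + g X) = subset_mean p E f + subset_mean p E g"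
  by (simp add: subset_mean_def distrib_left sum.distrib)

lemma subset_mean_cmult: "subset_mean p E (\<lambda>X. c * f X) = c * subset_mean p E f"
  by (simp add: subset_mean_def sum_distrib_left mult_ac)

lemma subset_mean_sum: "subset_mean p E (\<lambda>X. \<Sum>i\<in>I. f i X) = (\<Sum>i\<in>I. subset_mean p E (f i))"
  unfolding subset_mean_def by (subst sum.swap) (simp add: sum_distrib_left)

lemma subset_mean_prod:
  assumes "finite E"
  shows "subset_mean p E (\<lambda>X. \<Prod>e\<in>E. g e (e \<in> X)) = (\<Prod>e\<in>E. p e * g e True + (1 - p e) * g e False)"
  using assms
proof (induction E rule: finite_induct)
  case (insert e E)
  have "subset_mean p E (\<lambda>X. \<Prod>e'\<in>insert e E. g e' (e' \<in> insert e X))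
      = subset_mean p E (\<lambda>X. g e True * (\<Prod>e\<in>E. g e (e \<in> X)))"
    by (intro subset_mean_cong refl) (use insert.hyps in \<open>auto intro!: prod.cong arg_cong[where f
      = "g _"]\<close>)
  moreover have "subset_mean p E (\<lambda>X. \<Prod>e'\<in>insert e E. g e' (e' \<in> X))
      = subset_mean p E (\<lambda>X. g e False * (\<Prod>e\<in>E. g e (e \<in> X)))"
  proof (intro subset_mean_cong refl)
    fix X assume "X \<subseteq> E"
    then have "e \<notin> X" using insert.hyps by auto
    then show "(\<Prod>e'\<in>insert e E. g e' (e' \<in> X)) = g e False * (\<Prod>e\<in>E. g e (e \<in> X))"
      using insert.hyps by simp
  qed
  ultimately show ?case
    using insert by (simp add: subset_mean_insert subset_mean_cmult algebra_simps)
qed simp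

lemma subset_mean_const: "finite E \<Longrightarrow> subset_mean p E (\<lambda>_. c) = c"
  using subset_mean_prod[of E p "\<lambda>_ _. 1"] subset_mean_cmult[of p E c "\<lambda>_. 1"] by simp

lemma subset_mean_mono:
  assumes "\<And>e. e \<in> E \<Longrightarrow> 0 \<le> p e \<and> p e \<le> 1" "\<And>X. X \<subseteq> E \<Longrightarrow> f X \<le> g X"
  shows "subset_mean p E f \<le> subset_mean p E g"
  unfolding subset_mean_def using assms
    by (intro sum_mono mult_left_mono subset_weight_nonneg) auto

lemma subset_mean_restrict:
  assumes "finite E" "A \<subseteq> E" "\<And>X. X \<subseteq> E \<Longrightarrow> f X = f (X \<inter> A)"
  shows "subset_mean p E f = subset_mean p A f"
proof -
  have "subset_mean p E f = subset_mean p (A \<union> (E - A)) f"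
    using assms(2) by (simp add: Un_absorb1)
  also have "\<dots> = subset_mean p A (\<lambda>X. subset_mean p (E - A) (\<lambda>Y. f (X \<union> Y)))"
    using assms(1,2) by (intro subset_mean_Un) (auto intro: finite_subset)
  also have "\<dots> = subset_mean p A (\<lambda>X. subset_mean p (E - A) (\<lambda>Y. f X))"
  proof (intro subset_mean_cong refl)
    fix X Y assume XY: "X \<subseteq> A" "Y \<subseteq> E - A"
    then have "f (X \<union> Y) = f ((X \<union> Y) \<inter> A)" using assms(2) by (intro assms(3)) auto
    moreover have "(X \<union> Y) \<inter> A = X" using XY by auto
    ultimately show "f (X \<union> Y) = f X" by simp
  qed
  finally show ?thesis using assms(1) by (simp add: subset_mean_const)
qed

text \<open>Independence: functionals of disjoint parts of the random subset are uncorrelated. It is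
  used for variances, for the count of flippable vertices, and to separate own edges from
  the rest.\<close>

lemma subset_mean_mult:
  assumes E: "finite E" and AB: "A \<subseteq> E" "B \<subseteq> E" "A \<inter> B = {}"
    and f: "\<And>X. X \<subseteq> E \<Longrightarrow> f X = f (X \<inter> A)" and g: "\<And>X. X \<subseteq> E \<Longrightarrow> g X = g (X \<inter> B)"
  shows "subset_mean p E (\<lambda>X. f X * g X) = subset_mean p E f * subset_mean p E g"
proof -
  have fin: "finite A" "finite B" using E AB by (auto intro: finite_subset)
  have "subset_mean p E (\<lambda>X. f X * g X) = subset_mean p (A \<union> B) (\<lambda>X. f X * g X)"
  proof (rule subset_mean_restrict)
    fix X assume X: "X \<subseteq> E"
    have "X \<inter> (A \<union> B) \<inter> A = X \<inter> A" "X \<inter> (A \<union> B) \<inter> B = X \<inter> B" by auto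
    then show "f X * g X = f (X \<inter> (A \<union> B)) * g (X \<inter> (A \<union> B))"
      using f[OF X] g[OF X] f[of "X \<inter> (A \<union> B)"] g[of "X \<inter> (A \<union> B)"] X by (metis inf.coboundedI1)
  qed (use E AB in auto)
  also have "\<dots> = subset_mean p A (\<lambda>X. subset_mean p B (\<lambda>Y. f (X \<union> Y) * g (X \<union> Y)))"
    using fin AB by (intro subset_mean_Un) auto
  also have "\<dots> = subset_mean p A (\<lambda>X. subset_mean p B (\<lambda>Y. f X * g Y))"
  proof (intro subset_mean_cong refl)
    fix X Y assume XY: "X \<subseteq> A" "Y \<subseteq> B"
    have "(X \<union> Y) \<inter> A = X" "(X \<union> Y) \<inter> B = Y" using XY AB by auto
    then show "f (X \<union> Y) * g (X \<union> Y) = f X * g Y"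
      using f[of "X \<union> Y"] g[of "X \<union> Y"] XY AB by (metis Un_least order_trans)
  qed
  also have "\<dots> = subset_mean p A f * subset_mean p B g"
    by (simp add: subset_mean_cmult subset_mean_cmult[of p A "subset_mean p B g" f, simplified
      mult.commute] mult.commute)
  also have "subset_mean p A f = subset_mean p E f"
    by (rule subset_mean_restrict[where f = f, OF E AB(1) f, symmetric])
  also have "subset_mean p B g = subset_mean p E g"
    by (rule subset_mean_restrict[where f = g, OF E AB(2) g, symmetric])
  finally show ?thesis .
qed

lemma subset_mean_square_sum:
  assumes "finite I" "\<And>i j. i \<in> I \<Longrightarrow> j \<in> I \<Longrightarrow> i \<noteq> j \<Longrightarrow> subset_mean p E (\<lambda>X. f i X * f j X) = 0"
  shows "subset_mean p E (\<lambda>X. (\<Sum>i\<in>I. f i X)\<^sup>2) = (\<Sum>i\<in>I. subset_mean p E (\<lambda>X. (f i X)\<^sup>2))"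
proof -
  have "subset_mean p E (\<lambda>X. (\<Sum>i\<in>I. f i X)\<^sup>2) = (\<Sum>i\<in>I. \<Sum>j\<in>I. subset_mean p E (\<lambda>X. f i X * f j X))"
    by (simp add: power2_eq_square sum_product subset_mean_sum)
  also have "\<dots> = (\<Sum>i\<in>I. \<Sum>j\<in>I. if j = i then subset_mean p E (\<lambda>X. (f i X)\<^sup>2) else 0)"
    using assms(2) by (intro sum.cong refl) (auto simp: power2_eq_square)
  also have "\<dots> = (\<Sum>i\<in>I. subset_mean p E (\<lambda>X. (f i X)\<^sup>2))"
    using assms(1) by simp
  finally show ?thesis .
qed


section \<open>Likelihood ratios of Bernoulli products\<close>

text \<open>The affinity of two Bernoulli laws; for product laws the affinities multiply.\<close>

definition bhattacharyya :: "real \<Rightarrow> real \<Rightarrow> real" where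
  "bhattacharyya p p' = sqrt (p * p') + sqrt ((1 - p) * (1 - p'))"

lemma bhattacharyya_commute: "bhattacharyya p p' = bhattacharyya p' p"
  by (simp add: bhattacharyya_def mult.commute)

lemma bhattacharyya_pos: "0 < p \<Longrightarrow> p < 1 \<Longrightarrow> 0 < p' \<Longrightarrow> p' < 1 \<Longrightarrow> 0 < bhattacharyya p p'"
  unfolding bhattacharyya_def by (intro add_pos_pos) auto

lemma bhattacharyya_same: "0 < p \<Longrightarrow> p < 1 \<Longrightarrow> bhattacharyya p p = 1"
  by (simp add: bhattacharyya_def)

lemma one_minus_bhattacharyya:
  assumes "0 \<le> p" "p \<le> 1" "0 \<le> p'" "p' \<le> 1"
  shows "1 - bhattacharyya p p' = ((sqrt p - sqrt p')\<^sup>2 + (sqrt (1 - p) - sqrt (1 - p'))\<^sup>2) / 2"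
  using assms by (simp add: bhattacharyya_def power2_diff real_sqrt_mult)

lemma bhattacharyya_le_1: "0 \<le> p \<Longrightarrow> p \<le> 1 \<Longrightarrow> 0 \<le> p' \<Longrightarrow> p' \<le> 1 \<Longrightarrow> bhattacharyya p p' \<le> 1"
  using one_minus_bhattacharyya[of p p'] by (smt (verit) divide_nonneg_pos zero_le_power2)

text \<open>The parameter of the Bernoulli law proportional to the geometric mean of the two given
  ones. It treats both laws alike, which makes it the cheapest law under which the
  likelihood ratio is balanced.\<close>

definition tilt :: "real \<Rightarrow> real \<Rightarrow> real" where
  "tilt p p' = sqrt (p * p') / bhattacharyya p p'"

lemma tilt_compl:
  assumes "0 < p" "p < 1" "0 < p'" "p' < 1"
  shows "1 - tilt p p' = sqrt ((1 - p) * (1 - p')) / bhattacharyya p p'"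
  using bhattacharyya_pos[OF assms] unfolding tilt_def
    by (simp add: divide_simps) (simp add: bhattacharyya_def)

lemma tilt_bounds:
  assumes "0 < p" "p < 1" "0 < p'" "p' < 1"
  shows "0 < tilt p p'" "tilt p p' < 1"
proof -
  show "0 < tilt p p'" using bhattacharyya_pos[OF assms] assms by (simp add: tilt_def)
  have "0 < 1 - tilt p p'" unfolding tilt_compl[OF assms]
    using bhattacharyya_pos[OF assms] assms by simp
  then show "tilt p p' < 1" by simp
qed

context
  fixes A :: "'e set" and p p' :: "'e \<Rightarrow> real"
  assumes A: "finite A"
    and p: "\<And>e. e \<in> A \<Longrightarrow> 0 < p e \<and> p e < 1"
    and p': "\<And>e. e \<in> A \<Longrightarrow> 0 < p' e \<and> p' e < 1"
begin

lemma subset_weight_geometric_mean: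
  "(\<Prod>e\<in>A. bhattacharyya (p e) (p' e)) * subset_weight (\<lambda>e. tilt (p e) (p' e)) A X
    = sqrt (subset_weight p A X * subset_weight p' A X)"
proof -
  have "(\<Prod>e\<in>A. bhattacharyya (p e) (p' e)) * subset_weight (\<lambda>e. tilt (p e) (p' e)) A X
      = (\<Prod>e\<in>A. sqrt ((if e \<in> X then p e else 1 - p e) * (if e \<in> X then p' e else 1 - p' e)))"
    unfolding subset_weight_def prod.distrib[symmetric]
  proof (intro prod.cong refl)
    fix e assume e: "e \<in> A"
    have "bhattacharyya (p e) (p' e) > 0" using p[OF e] p'[OF e] by (intro bhattacharyya_pos) auto
    then show "bhattacharyya (p e) (p' e)
      * (if e \<in> X then tilt (p e) (p' e) else 1 - tilt (p e) (p' e))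
      = sqrt ((if e \<in> X then p e else 1 - p e) * (if e \<in> X then p' e else 1 - p' e))"
      using p[OF e] p'[OF e] by (simp add: tilt_compl) (simp add: tilt_def)
  qed
  also have "\<dots> = sqrt (subset_weight p A X * subset_weight p' A X)"
    unfolding subset_weight_def prod.distrib[symmetric] using A
    by (induction A rule: finite_induct) (auto simp: real_sqrt_mult)
  finally show ?thesis .
qed

lemma ln_weight_ratio:
  "ln (subset_weight p' A X / subset_weight p A X)
    = (\<Sum>e\<in>A. if e \<in> X then ln (p' e / p e) else ln ((1 - p' e) / (1 - p e)))"
proof -
  have "subset_weight p' A X / subset_weight p A X
      = (\<Prod>e\<in>A. if e \<in> X then p' e / p e else (1 - p' e) / (1 - p e))"
    unfolding subset_weight_def prod_dividef[symmetric] by (intro prod.cong) auto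
  also have "ln \<dots> = (\<Sum>e\<in>A. ln (if e \<in> X then p' e / p e else (1 - p' e) / (1 - p e)))"
    using p p' by (intro ln_prod A) (auto simp: less_imp_neq[symmetric])
  finally show ?thesis by (simp add: if_distrib)
qed

text \<open>Cramer's change of measure. The law \<open>p\<close> equals the geometric mean of \<open>p\<close> and \<open>p'\<close>, which
  is the product of the affinities times \<open>r\<close>, times the root of the likelihood ratio of
  \<open>p\<close> to \<open>p'\<close>. On the event that the logarithm of the ratio lies in \<open>[-2x, 2x]\<close> that root
  is at least \<open>exp (- x)\<close>, and Chebyshev's inequality bounds the \<open>r\<close>-probability of this
  event from below.\<close>

lemma tilting_lower_bound:
  defines "r \<equiv> \<lambda>e. tilt (p e) (p' e)"
  assumes x: "0 < x"
  shows "(\<Prod>e\<in>A. bhattacharyya (p e) (p' e)) * exp (- x)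
      * (1 - subset_mean r A (\<lambda>X. (ln (subset_weight p' A X / subset_weight p A X))\<^sup>2) / (2
        * x)\<^sup>2)
    \<le> subset_mean p A (\<lambda>X. of_bool (exp (- 2 * x) * subset_weight p A X \<le> subset_weight p' A X))"
proof -
  define Z where "Z = (\<Prod>e\<in>A. bhattacharyya (p e) (p' e))"
  have Z: "0 < Z" unfolding Z_def using p p' by (intro prod_pos bhattacharyya_pos) auto
  have r: "0 < r e \<and> r e < 1" if "e \<in> A" for e
    unfolding r_def using p[OF that] p'[OF that] tilt_bounds[of "p e" "p' e"] by auto
  let ?G = "\<lambda>X. \<bar>ln (subset_weight p' A X / subset_weight p A X)\<bar> \<le> 2 * x"
  have cheb: "1 - subset_mean r A (\<lambda>X. (ln (subset_weight p' A X / subset_weight p A X))\<^sup>2) / (2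
    * x)\<^sup>2
      \<le> subset_mean r A (\<lambda>X. of_bool (?G X))"
  proof -
    have "1 - subset_mean r A (\<lambda>X. (ln (subset_weight p' A X / subset_weight p A X))\<^sup>2) / (2
      * x)\<^sup>2
        = subset_mean r A (\<lambda>X. 1
          + - (1 / (2 * x)\<^sup>2) * (ln (subset_weight p' A X / subset_weight p A X))\<^sup>2)"
      unfolding subset_mean_add subset_mean_cmult using A by (simp add: subset_mean_const)
    also have "\<dots> \<le> subset_mean r A (\<lambda>X. of_bool (?G X))"
    proof (rule subset_mean_mono)
      fix X
      have "1 \<le> y\<^sup>2 / (2 * x)\<^sup>2" if "\<not> \<bar>y\<bar> \<le> 2 * x" for y :: real
        using that x abs_le_square_iff[of "2 * x" y] by (simp add: field_simps)
      then show "1 + - (1 / (2 * x)\<^sup>2) * (ln (subset_weight p' A X / subset_weight p A X))\<^sup>2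
        \<le> of_bool (?G X)"
        by (auto simp: of_bool_def)
    qed (use r in \<open>auto intro: less_imp_le\<close>)
    finally show ?thesis .
  qed
  have "Z * exp (- x) * subset_mean r A (\<lambda>X. of_bool (?G X))
      = (\<Sum>X\<in>Pow A. exp (- x) * (Z * subset_weight r A X) * of_bool (?G X))"
    by (simp add: subset_mean_def sum_distrib_left mult_ac)
  also have "\<dots> \<le> (\<Sum>X\<in>Pow A. subset_weight p A X * of_bool (exp (- 2 * x) * subset_weight p A X
    \<le> subset_weight p' A X))"
  proof (intro sum_mono)
    fix X
    define w w' where "w = subset_weight p A X" and "w' = subset_weight p' A X"
    have w: "0 < w" "0 < w'" unfolding w_def w'_def using p p' by (auto intro: subset_weight_pos)
    have "exp (- x) * (Z * subset_weight r A X) = exp (- x) * sqrt (w * w')"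
      unfolding Z_def r_def subset_weight_geometric_mean w_def w'_def ..
    moreover have "exp (- x) * sqrt (w * w') \<le> w \<and> exp (- 2 * x) * w \<le> w'" if "?G X"
    proof -
      have "ln (w' / w) \<le> 2 * x" "- 2 * x \<le> ln (w' / w)" using that by (auto simp: w_def w'_def)
      then have "w' / w \<le> exp (2 * x)" "exp (- 2 * x) \<le> w' / w"
        using w by (metis divide_pos_pos exp_le_cancel_iff exp_ln)+
      then have 1: "w' \<le> exp (2 * x) * w" "exp (- 2 * x) * w \<le> w'"
        using w by (auto simp: field_simps)
      have "sqrt (w * w') \<le> sqrt (w * (exp (2 * x) * w))"
        using w 1 by (intro real_sqrt_le_mono mult_left_mono) auto
      also have "\<dots> = sqrt ((exp x * w)\<^sup>2)"
        by (simp add: power2_eq_square mult_exp_exp mult_ac)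
      also have "\<dots> = exp x * w" using w by simp
      finally have "exp (- x) * sqrt (w * w') \<le> exp (- x) * (exp x * w)" by simp
      also have "\<dots> = w" by (simp add: exp_minus)
      finally show ?thesis using 1 by simp
    qed
    ultimately show "exp (- x) * (Z * subset_weight r A X) * of_bool (?G X)
        \<le> subset_weight p A X * of_bool (exp (- 2 * x) * subset_weight p A X
          \<le> subset_weight p' A X)"
      using w unfolding w_def w'_def by (auto simp: of_bool_def)
  qed
  also have "\<dots> = subset_mean p A (\<lambda>X. of_bool (exp (- 2 * x) * subset_weight p A X
    \<le> subset_weight p' A X))"
    by (simp add: subset_mean_def)
  finally show ?thesis
    using order_trans[OF mult_left_mono[OF cheb, of "Z * exp (- x)"]] Z unfolding Z_def by simp
qed

text \<open>The log-likelihood ratio is a sum of independent contributions of the elements, each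
  taking two values. The second moment is the variance as soon as the total mean vanishes;
  the single means need not vanish.\<close>

lemma second_moment_tilted:
  defines "r \<equiv> \<lambda>e. tilt (p e) (p' e)"
  assumes centred: "(\<Sum>e\<in>A. r e * ln (p' e / p e) + (1 - r e) * ln ((1 - p' e) / (1 - p e))) = 0"
  shows "subset_mean r A (\<lambda>X. (ln (subset_weight p' A X / subset_weight p A X))\<^sup>2)
    = (\<Sum>e\<in>A. r e * (1 - r e) * (ln (p' e / p e) - ln ((1 - p' e) / (1 - p e)))\<^sup>2)"
proof -
  define l1 l0 where "l1 e = ln (p' e / p e)" and "l0 e = ln ((1 - p' e) / (1 - p e))" for e
  define f where "f e X = (if e \<in> X then l1 e else l0 e) - (r e * l1 e
    + (1 - r e) * l0 e)" for e X
  have f_restr: "subset_mean r A (\<lambda>X. g (f e X)) = r e * g (f e {e}) + (1 - r e) * g (f e {})"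
    if "e \<in> A" for e and g :: "real \<Rightarrow> real"
  proof -
    have "subset_mean r A (\<lambda>X. g (f e X)) = subset_mean r {e} (\<lambda>X. g (f e X))"
      by (rule subset_mean_restrict[OF A]) (use that in \<open>auto simp: f_def\<close>)
    then show ?thesis by (simp add: subset_mean_singleton)
  qed
  have mean0: "subset_mean r A (f e) = 0" if "e \<in> A" for e
  proof -
    have "subset_mean r A (f e) = r e * f e {e} + (1 - r e) * f e {}"
      by (rule f_restr[OF that, of "\<lambda>x. x"])
    also have "\<dots> = 0" by (simp add: f_def algebra_simps)
    finally show ?thesis .
  qed
  have "ln (subset_weight p' A X / subset_weight p A X) = (\<Sum>e\<in>A. f e X)" for X
    using centred unfolding ln_weight_ratio f_def sum_subtractf l1_def l0_def by simp
  then have "subset_mean r A (\<lambda>X. (ln (subset_weight p' A X / subset_weight p A X))\<^sup>2)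
    = subset_mean r A (\<lambda>X. (\<Sum>e\<in>A. f e X)\<^sup>2)"
    by simp
  also have "\<dots> = (\<Sum>e\<in>A. subset_mean r A (\<lambda>X. (f e X)\<^sup>2))"
  proof (rule subset_mean_square_sum[OF A])
    fix i j assume ij: "i \<in> A" "j \<in> A" "i \<noteq> j"
    have "subset_mean r A (\<lambda>X. f i X * f j X) = subset_mean r A (f i) * subset_mean r A (f j)"
      by (rule subset_mean_mult[OF A, of "{i}" "{j}"]) (use ij in \<open>auto simp: f_def\<close>)
    then show "subset_mean r A (\<lambda>X. f i X * f j X) = 0" using mean0 ij by simp
  qed
  also have "\<dots> = (\<Sum>e\<in>A. r e * (1 - r e) * (l1 e - l0 e)\<^sup>2)"
  proof (intro sum.cong refl)
    fix e assume "e \<in> A"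
    from f_restr[OF this, of "\<lambda>x. x\<^sup>2"]
    show "subset_mean r A (\<lambda>X. (f e X)\<^sup>2) = r e * (1 - r e) * (l1 e - l0 e)\<^sup>2"
      by (simp add: f_def power2_eq_square algebra_simps)
  qed
  finally show ?thesis by (simp add: l1_def l0_def)
qed

text \<open>If the ratio is below \<open>1/4\<close>, then \<open>(sqrt w - sqrt w')^2 \<ge> w / 4\<close>, so the probability is
  at most four times the squared Hellinger distance; the latter is \<open>2 - 2 * Z\<close> with the
  product \<open>Z\<close> of the affinities.\<close>

lemma likelihood_ratio_small:
  "subset_mean p A (\<lambda>X. of_bool (subset_weight p' A X < subset_weight p A X / 4))
    \<le> 8 * (\<Sum>e\<in>A. 1 - bhattacharyya (p e) (p' e))"
proof -
  define Z where "Z = (\<Prod>e\<in>A. bhattacharyya (p e) (p' e))"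
  have "subset_mean p A (\<lambda>X. of_bool (subset_weight p' A X < subset_weight p A X / 4))
      \<le> (\<Sum>X\<in>Pow A. 4 * subset_weight p A X
        + 4 * subset_weight p' A X - 8 * sqrt (subset_weight p A X * subset_weight p' A X))"
    unfolding subset_mean_def
  proof (rule sum_mono)
    fix X
    define w w' where "w = subset_weight p A X" and "w' = subset_weight p' A X"
    have w: "0 < w" "0 < w'" unfolding w_def w'_def using p p' by (auto intro: subset_weight_pos)
    have sq: "4 * w + 4 * w' - 8 * sqrt (w * w') = 4 * (sqrt w - sqrt w')\<^sup>2"
      using w by (simp add: power2_diff real_sqrt_mult)
    have "w * of_bool (w' < w / 4) \<le> 4 * (sqrt w - sqrt w')\<^sup>2"
    proof (cases "w' < w / 4")
      case True
      then have "sqrt w' \<le> sqrt (w / 4)" by (intro real_sqrt_le_mono) auto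
      then have "sqrt w / 2 \<le> sqrt w - sqrt w'" by (simp add: real_sqrt_divide)
      then have "(sqrt w / 2)\<^sup>2 \<le> (sqrt w - sqrt w')\<^sup>2" using w by (intro power_mono) auto
      then show ?thesis using w True by (simp add: power_divide)
    qed simp
    then show "subset_weight p A X * of_bool (subset_weight p' A X < subset_weight p A X / 4)
        \<le> 4 * subset_weight p A X
          + 4 * subset_weight p' A X - 8 * sqrt (subset_weight p A X * subset_weight p' A X)"
      using sq unfolding w_def w'_def by simp
  qed
  also have "\<dots> = 4 * subset_mean p A (\<lambda>_. 1) + 4 * subset_mean p' A (\<lambda>_. 1)
      - 8 * (Z * subset_mean (\<lambda>e. tilt (p e) (p' e)) A (\<lambda>_. 1))"
    unfolding subset_mean_def Z_def subset_weight_geometric_mean[symmetric]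
    by (simp add: sum_subtractf sum.distrib sum_distrib_left)
  also have "\<dots> = 8 * (1 - Z)" using A by (simp add: subset_mean_const)
  also have "1 - Z \<le> (\<Sum>e\<in>A. 1 - bhattacharyya (p e) (p' e))"
  proof -
    have "1 - (\<Sum>e\<in>A. 1 - bhattacharyya (p e) (p' e))
      \<le> (\<Prod>e\<in>A. 1 - (1 - bhattacharyya (p e) (p' e)))"
      using p p' by (intro Weierstrass_prod_ineq)
        (auto intro!: bhattacharyya_le_1 less_imp_le[OF bhattacharyya_pos] simp: less_imp_le)
    then show ?thesis by (simp add: Z_def)
  qed
  finally show ?thesis by simp
qed

end


section \<open>Estimates for two close small probabilities\<close>

text \<open>The geometric mean is at most the logarithmic mean, up to a constant. With \<open>a\<close> and \<open>b\<close>
  the fourth roots, \<open>ln (a / b) \<le> a / b - 1\<close> is enough for the constant \<open>16\<close>.\<close>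

lemma sqrt_mult_ln_squared_le:
  fixes u v :: real
  assumes "0 < v" "v \<le> u"
  shows "sqrt (u * v) * (ln (u / v))\<^sup>2 \<le> 16 * (sqrt u - sqrt v)\<^sup>2"
proof -
  define a b where "a = sqrt (sqrt u)" and "b = sqrt (sqrt v)"
  have ab: "0 < b" "b \<le> a" using assms by (auto simp: a_def b_def)
  have squ: "sqrt u = a\<^sup>2" "sqrt v = b\<^sup>2"
    unfolding a_def b_def using assms by auto
  have "u = (sqrt u)\<^sup>2" "v = (sqrt v)\<^sup>2" using assms by auto
  then have u: "u = a ^ 4" and v: "v = b ^ 4" unfolding squ by (auto simp flip: power_mult)
  have "ln (u / v) = 4 * ln (a / b)"
    using ab by (simp add: u v power_divide[symmetric] ln_realpow)
  moreover have "0 \<le> ln (a / b)" using ab by simp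
  moreover have "ln (a / b) \<le> a / b - 1" using ab by (intro ln_le_minus_one) auto
  ultimately have ln: "0 \<le> ln (u / v)" "ln (u / v) \<le> 4 * (a - b) / b"
    using ab by (simp_all add: field_simps)
  have "sqrt (u * v) * (ln (u / v))\<^sup>2 = (a * b * ln (u / v))\<^sup>2"
    using squ by (simp add: real_sqrt_mult power_mult_distrib)
  also have "\<dots> \<le> (a * b * (4 * (a - b) / b))\<^sup>2"
    using ab ln by (intro power_mono mult_left_mono) auto
  also have "a * b * (4 * (a - b) / b) = 4 * (a * (a - b))" using ab by simp
  also have "(4 * (a * (a - b)))\<^sup>2 \<le> (4 * ((a + b) * (a - b)))\<^sup>2"
    using ab by (intro power_mono mult_left_mono mult_right_mono) auto
  also have "\<dots> = 16 * (sqrt u - sqrt v)\<^sup>2"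
    unfolding squ by (simp add: power2_eq_square algebra_simps)
  finally show ?thesis .
qed

context
  fixes \<alpha> \<beta> s :: real
  assumes \<beta>: "0 < \<beta>" "\<beta> \<le> \<alpha>" and \<alpha>: "\<alpha> \<le> s" and s: "s \<le> 1 / 2"
begin

text \<open>Absent edges contribute a lower order to the Hellinger distance: both differences of
  roots come from the same difference \<open>\<alpha> - \<beta>\<close>, divided by the sums of the respective
  roots, of which only \<open>sqrt \<alpha> + sqrt \<beta>\<close> is small.\<close>

lemma sqrt_compl_diff_le:
  "(sqrt (1 - \<alpha>) - sqrt (1 - \<beta>))\<^sup>2 \<le> (sqrt \<alpha> - sqrt \<beta>)\<^sup>2 * (s / (1 - s))"
proof -
  define D where "D = (sqrt (1 - \<alpha>) - sqrt (1 - \<beta>))\<^sup>2"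
  have "(sqrt (1 - \<alpha>) - sqrt (1 - \<beta>)) * (sqrt (1 - \<alpha>) + sqrt (1 - \<beta>)) = \<beta> - \<alpha>"
    using \<beta> \<alpha> s by (simp add: algebra_simps)
  then have 1: "D * (sqrt (1 - \<alpha>) + sqrt (1 - \<beta>))\<^sup>2 = (\<alpha> - \<beta>)\<^sup>2"
    unfolding D_def by (metis power_mult_distrib power2_commute)
  have "(sqrt \<alpha> - sqrt \<beta>) * (sqrt \<alpha> + sqrt \<beta>) = \<alpha> - \<beta>"
    using \<beta> by (simp add: algebra_simps)
  then have 2: "(\<alpha> - \<beta>)\<^sup>2 = (sqrt \<alpha> - sqrt \<beta>)\<^sup>2 * (sqrt \<alpha> + sqrt \<beta>)\<^sup>2"
    by (metis power_mult_distrib)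
  have "sqrt \<alpha> \<le> sqrt s" "sqrt \<beta> \<le> sqrt s" using \<beta> \<alpha> by auto
  then have "sqrt \<alpha> + sqrt \<beta> \<le> 2 * sqrt s" by linarith
  then have "(sqrt \<alpha> + sqrt \<beta>)\<^sup>2 \<le> (2 * sqrt s)\<^sup>2" using \<beta> by (intro power_mono) auto
  then have 3: "(sqrt \<alpha> + sqrt \<beta>)\<^sup>2 \<le> 4 * s" using \<beta> \<alpha> by (simp add: power_mult_distrib)
  have "sqrt (1 - s) \<le> sqrt (1 - \<alpha>)" "sqrt (1 - s) \<le> sqrt (1 - \<beta>)" using \<beta> \<alpha> by auto
  then have "2 * sqrt (1 - s) \<le> sqrt (1 - \<alpha>) + sqrt (1 - \<beta>)" by linarith
  then have "(2 * sqrt (1 - s))\<^sup>2 \<le> (sqrt (1 - \<alpha>) + sqrt (1 - \<beta>))\<^sup>2"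
    using s by (intro power_mono) auto
  then have 4: "4 * (1 - s) \<le> (sqrt (1 - \<alpha>) + sqrt (1 - \<beta>))\<^sup>2"
    using s by (simp add: power_mult_distrib)
  have "D * (4 * (1 - s)) \<le> D * (sqrt (1 - \<alpha>) + sqrt (1 - \<beta>))\<^sup>2"
    by (rule mult_left_mono[OF 4]) (simp add: D_def)
  also have "\<dots> \<le> (sqrt \<alpha> - sqrt \<beta>)\<^sup>2 * (4 * s)"
    unfolding 1 2 by (rule mult_left_mono[OF 3]) simp
  finally show ?thesis using s unfolding D_def[symmetric] by (simp add: field_simps)
qed

lemma one_minus_bhattacharyya_le: "1 - bhattacharyya \<alpha> \<beta> \<le> (sqrt \<alpha> - sqrt \<beta>)\<^sup>2 / (2 * (1 - s))"
proof -
  define h where "h = (sqrt \<alpha> - sqrt \<beta>)\<^sup>2"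
  have "1 - bhattacharyya \<alpha> \<beta> \<le> (h + h * (s / (1 - s))) / 2"
    using sqrt_compl_diff_le one_minus_bhattacharyya[of \<alpha> \<beta>] \<beta> \<alpha> s unfolding h_def by auto
  also have "\<dots> = h / (2 * (1 - s))" using s by (simp add: field_simps)
  finally show ?thesis unfolding h_def .
qed

lemma sqrt_diff_squared_le: "(sqrt \<alpha> - sqrt \<beta>)\<^sup>2 \<le> s"
proof -
  have "(sqrt \<alpha> - sqrt \<beta>)\<^sup>2 \<le> (sqrt \<alpha>)\<^sup>2" using \<beta> by (intro power_mono) auto
  then show ?thesis using \<beta> \<alpha> by simp
qed

lemma bhattacharyya_ge: "1 - s \<le> bhattacharyya \<alpha> \<beta>"
proof -
  have "1 - bhattacharyya \<alpha> \<beta> \<le> s / (2 * (1 - s))"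
    using order_trans[OF one_minus_bhattacharyya_le divide_right_mono[OF sqrt_diff_squared_le]] s
      by simp
  also have "\<dots> \<le> s / 1" using s \<beta> \<alpha> by (intro divide_left_mono) auto
  finally show ?thesis by simp
qed

text \<open>As \<open>s\<close> tends to \<open>0\<close> the constant tends to \<open>1 / 2\<close>. This is the sharp constant, on which
  the location of the threshold depends.\<close>

lemma ln_bhattacharyya_ge: "- ((sqrt \<alpha> - sqrt \<beta>)\<^sup>2 / (2 * (1 - s)\<^sup>2)) \<le> ln (bhattacharyya \<alpha> \<beta>)"
proof -
  have b: "0 < bhattacharyya \<alpha> \<beta>" "1 - s > 0" using bhattacharyya_ge s by auto
  have "- ln (bhattacharyya \<alpha> \<beta>) \<le> 1 / bhattacharyya \<alpha> \<beta> - 1"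
    using ln_le_minus_one[of "1 / bhattacharyya \<alpha> \<beta>"] b by (simp add: ln_div)
  also have "\<dots> = (1 - bhattacharyya \<alpha> \<beta>) / bhattacharyya \<alpha> \<beta>" using b by (simp add: field_simps)
  also have "\<dots> \<le> (sqrt \<alpha> - sqrt \<beta>)\<^sup>2 / (2 * (1 - s)) / (1 - s)"
    using one_minus_bhattacharyya_le bhattacharyya_ge b by (intro frac_le) auto
  also have "\<dots> = (sqrt \<alpha> - sqrt \<beta>)\<^sup>2 / (2 * (1 - s)\<^sup>2)" by (simp add: power2_eq_square)
  finally show ?thesis by linarith
qed

text \<open>The variance of the log-likelihood ratio is controlled by the same Hellinger distance
  that defines \<open>D_GH\<close>, hence the fluctuations are of order \<open>sqrt (log N)\<close>, negligible
  against the threshold \<open>x\<close>, even if the \<open>a\<^sub>\<ell>\<close> grow polynomially.\<close>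

lemma tilted_variance_le:
  "tilt \<alpha> \<beta> * (1 - tilt \<alpha> \<beta>) * (ln (\<beta> / \<alpha>) - ln ((1 - \<beta>) / (1 - \<alpha>)))\<^sup>2
    \<le> 256 * (sqrt \<alpha> - sqrt \<beta>)\<^sup>2"
proof -
  define h where "h = (sqrt \<alpha> - sqrt \<beta>)\<^sup>2"
  define P Q where "P = sqrt (\<alpha> * \<beta>)" and "Q = sqrt ((1 - \<alpha>) * (1 - \<beta>))"
  define A B where "A = ln (\<alpha> / \<beta>)" and "B = ln ((1 - \<beta>) / (1 - \<alpha>))"
  have lt: "0 < \<alpha>" "\<alpha> < 1" "\<beta> < 1" using \<beta> \<alpha> s by auto
  have PQ: "0 \<le> P" "P \<le> 1" "0 \<le> Q" "Q \<le> 1"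
    using \<beta> \<alpha> s by (auto simp: P_def Q_def mult_le_one)
  have PA: "P * A\<^sup>2 \<le> 16 * h"
    using sqrt_mult_ln_squared_le[of \<beta> \<alpha>] \<beta> by (simp add: P_def A_def h_def)
  have "Q * B\<^sup>2 \<le> 16 * (sqrt (1 - \<alpha>) - sqrt (1 - \<beta>))\<^sup>2"
    using sqrt_mult_ln_squared_le[of "1 - \<alpha>" "1 - \<beta>"] \<beta> \<alpha> s
    by (simp add: Q_def B_def mult.commute power2_commute)
  also have "\<dots> \<le> 16 * (h * (s / (1 - s)))"
    using sqrt_compl_diff_le by (simp add: h_def)
  also have "\<dots> \<le> 16 * (h * 1)"
    using s by (intro mult_left_mono) (auto simp: h_def divide_simps)
  finally have QB: "Q * B\<^sup>2 \<le> 16 * h" by simp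
  have h0: "0 \<le> h" by (simp add: h_def)
  have "P * Q * (A + B)\<^sup>2 \<le> P * Q * (2 * A\<^sup>2 + 2 * B\<^sup>2)"
    using PQ sum_squares_bound[of A B] by (intro mult_left_mono) (auto simp: power2_sum)
  also have "\<dots> = 2 * (Q * (P * A\<^sup>2)) + 2 * (P * (Q * B\<^sup>2))" by (simp add: algebra_simps)
  also have "Q * (P * A\<^sup>2) \<le> 1 * (16 * h)"
    by (rule mult_mono) (use PA PQ h0 in auto)
  also have "P * (Q * B\<^sup>2) \<le> 1 * (16 * h)"
    by (rule mult_mono) (use QB PQ h0 in auto)
  finally have main: "P * Q * (A + B)\<^sup>2 \<le> 64 * h" by simp
  have b: "1 / 2 \<le> bhattacharyya \<alpha> \<beta>" using bhattacharyya_ge s by simp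
  have "ln (\<beta> / \<alpha>) = - A" using \<beta> lt by (simp add: A_def ln_div)
  then have eq: "(ln (\<beta> / \<alpha>) - ln ((1 - \<beta>) / (1 - \<alpha>)))\<^sup>2 = (A + B)\<^sup>2"
    unfolding B_def by (simp add: power2_eq_square algebra_simps)
  have "tilt \<alpha> \<beta> * (1 - tilt \<alpha> \<beta>) = P * Q / (bhattacharyya \<alpha> \<beta>)\<^sup>2"
    using tilt_compl[of \<alpha> \<beta>] \<beta> lt by (simp add: tilt_def P_def Q_def power2_eq_square)
  then have "tilt \<alpha> \<beta> * (1 - tilt \<alpha> \<beta>) * (A + B)\<^sup>2 = P * Q * (A + B)\<^sup>2 / (bhattacharyya \<alpha> \<beta>)\<^sup>2"
    by simp
  also have "\<dots> \<le> (64 * h) / (1 / 2)\<^sup>2"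
    using main b h0 by (intro frac_le power_mono) auto
  finally show ?thesis unfolding eq h_def by (simp add: power2_eq_square)
qed

end


section \<open>Balanced labels and the edges affected by a swap\<close>

definition swap_labels :: "nat \<Rightarrow> nat \<Rightarrow> (nat \<Rightarrow> int) \<Rightarrow> nat \<Rightarrow> int" where
  "swap_labels u w y = y(u := y w, w := y u)"

lemma swap_labels_commute: "swap_labels u w y = swap_labels w u y"
  by (auto simp: swap_labels_def fun_eq_iff)

text \<open>The unmarked vertices of one class make up at most half of the vertices other than a
  given one, so at most the part \<open>2 powr (1 - l)\<close> of the edges at a vertex lies in a given
  class. This is the weight in \<open>D_GH\<close>.\<close>

lemma binomial_half_le: "2 * m \<le> M \<Longrightarrow> (m choose k) * 2 ^ k \<le> M choose k"
proof (induction k)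
  case (Suc k)
  have absorb: "Suc k * (r choose Suc k) = (r - k) * (r choose k)" for r
    using binomial_absorption[of k r] binomial_absorb_comp[of r k] by simp
  have "Suc k * ((m choose Suc k) * 2 ^ Suc k) = (2 * (m - k)) * ((m choose k) * 2 ^ k)"
    using absorb[of m] by (simp del: mult_Suc mult_Suc_right binomial_Suc_Suc)
  also have "\<dots> \<le> (M - k) * (M choose k)"
    using Suc by (intro mult_le_mono) auto
  also have "\<dots> = Suc k * (M choose Suc k)" using absorb[of M] by simp
  finally show ?case by (simp del: mult_Suc)
qed simp

lemma sum_pm_one:
  assumes "finite A" "\<And>v. v \<in> A \<Longrightarrow> y v = 1 \<or> y v = (-1 :: int)"
  shows "sum y A = int (card {v\<in>A. y v = 1}) - int (card {v\<in>A. y v = -1})"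
    and "card A = card {v\<in>A. y v = 1} + card {v\<in>A. y v = -1}"
proof -
  have *: "{v\<in>A. y v = 1} \<union> {v\<in>A. y v = -1} = A" using assms by auto
  have disj: "{v\<in>A. y v = 1} \<inter> {v\<in>A. y v = -1} = {}" by auto
  show "card A = card {v\<in>A. y v = 1} + card {v\<in>A. y v = -1}"
    using card_Un_disjoint[OF _ _ disj] * assms(1) by simp
  have "sum y A = sum y {v\<in>A. y v = 1} + sum y {v\<in>A. y v = -1}"
    using sum.union_disjoint[OF _ _ disj, of y] * assms(1) by simp
  also have "sum y {v\<in>A. y v = 1} = sum (\<lambda>_. 1) {v\<in>A. y v = 1}" by (intro sum.cong) auto
  also have "sum y {v\<in>A. y v = -1} = sum (\<lambda>_. -1) {v\<in>A. y v = -1}" by (intro sum.cong) auto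
  finally show "sum y A = int (card {v\<in>A. y v = 1}) - int (card {v\<in>A. y v = -1})" by simp
qed

lemma finite_balanced_labels: "finite (balanced_labels N)"
  by (rule finite_subset[OF _ finite_PiE[of "{..<N}" "\<lambda>_. {-1, 1 :: int}"]])
    (auto simp: balanced_labels_def)

lemma balanced_labelsD:
  assumes "y \<in> balanced_labels N"
  shows "v < N \<Longrightarrow> y v = 1 \<or> y v = -1"
    and "\<sigma> \<in> {-1, 1} \<Longrightarrow> 2 * card {v\<in>{..<N}. y v = \<sigma>} = N"
proof -
  show pm: "y v = 1 \<or> y v = -1" if "v < N" for v
    using assms that by (auto simp: balanced_labels_def PiE_iff)
  have "sum y {..<N} = 0" using assms by (simp add: balanced_labels_def)
  with sum_pm_one[of "{..<N}" y] pm
  show "2 * card {v\<in>{..<N}. y v = \<sigma>} = N" if "\<sigma> \<in> {-1, 1}" using that by auto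
qed

lemma swap_labels_balanced:
  assumes "y \<in> balanced_labels N" "u < N" "w < N"
  shows "swap_labels u w y \<in> balanced_labels N"
proof (cases "u = w")
  case True
  then show ?thesis using assms by (simp add: swap_labels_def)
next
  case False
  have "(\<Sum>v<N. swap_labels u w y v) = (\<Sum>v<N. y v)"
    by (rule sum.reindex_bij_witness[of _ "\<lambda>v. if v = u then w else if v = w then u else v"
          "\<lambda>v. if v = u then w else if v = w then u else v"])
      (use assms False in \<open>auto simp: swap_labels_def split: if_splits\<close>)
  then show ?thesis using assms
    by (auto simp: balanced_labels_def swap_labels_def PiE_iff extensional_def)
qed

lemma finite_potential_edges: "finite (potential_edges L N)"
  by (rule finite_subset[of _ "Pow {..<N}"]) (auto simp: potential_edges_def)

text \<open>Here \<open>\<alpha>\<close> and \<open>\<beta>\<close> are the edge probabilities themselves. The smaller their common bound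
  \<open>s\<close>, the closer the exponents below are to the sharp ones.\<close>

locale block_model =
  fixes N :: nat and L :: "nat set" and \<alpha> \<beta> :: "nat \<Rightarrow> real" and s :: real
  assumes finite_L: "finite L" and L_ge_2: "l \<in> L \<Longrightarrow> 2 \<le> l"
    and beta_pos: "l \<in> L \<Longrightarrow> 0 < \<beta> l" and beta_le_alpha: "l \<in> L \<Longrightarrow> \<beta> l \<le> \<alpha> l"
    and alpha_le: "l \<in> L \<Longrightarrow> \<alpha> l \<le> s" and s_le: "s \<le> 1 / 2"
begin

abbreviation E :: "nat set set" where "E \<equiv> potential_edges L N"

definition edge_param :: "(nat \<Rightarrow> int) \<Rightarrow> nat set \<Rightarrow> real" where
  "edge_param y e = (if monochromatic y e then \<alpha> (card e) else \<beta> (card e))"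

definition hellinger_gap :: "nat \<Rightarrow> real" where
  "hellinger_gap l = (sqrt (\<alpha> l) - sqrt (\<beta> l))\<^sup>2"

text \<open>This is \<open>D_GH * q\<close> in terms of the edge probabilities, see \<open>signal_eq_D_GH\<close>.\<close>

definition signal :: real where
  "signal = (\<Sum>l\<in>L. real ((N - 1) choose (l - 1)) * hellinger_gap l / 2 ^ (l - 1))"

lemma finite_E: "finite E" by (rule finite_potential_edges)

lemma hellinger_gap_nonneg: "0 \<le> hellinger_gap l" by (simp add: hellinger_gap_def)

lemma edge_param_bounds: "e \<in> E \<Longrightarrow> 0 < edge_param y e \<and> edge_param y e < 1"
  using beta_pos[of "card e"] beta_le_alpha[of "card e"] alpha_le[of "card e"] s_le
  by (auto simp: edge_param_def potential_edges_def)

end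

text \<open>The set \<open>T\<close> of marked vertices contains \<open>t\<close> of each class. Keeping it small makes edges
  with two marked vertices rare; keeping it larger than the inverse flipping probability
  makes it contain flippable vertices.\<close>

locale marked_labels = block_model +
  fixes y :: "nat \<Rightarrow> int" and T :: "nat set" and t :: nat
  assumes y: "y \<in> balanced_labels N" and T: "T \<subseteq> {..<N}"
    and card_T: "\<sigma> \<in> {-1, 1} \<Longrightarrow> card {v\<in>T. y v = \<sigma>} = t" and t_pos: "1 \<le> t"
begin

definition n_out :: nat where "n_out = N div 2 - t"

text \<open>The edges through \<open>u\<close> whose status depends on the label of \<open>u\<close>, as far as they contain
  no other marked vertex.\<close>

definition own_edges :: "nat \<Rightarrow> nat set set" where
  "own_edges u = {e \<in> E. e \<inter> T = {u} \<and> monochromatic y (e - {u})}"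

definition other_edges :: "nat set set" where
  "other_edges = E - (\<Union>u\<in>T. own_edges u)"

text \<open>The parameter that results when one vertex of an own edge changes its label.\<close>

definition flipped_param :: "nat set \<Rightarrow> real" where
  "flipped_param e = (if monochromatic y e then \<beta> (card e) else \<alpha> (card e))"

lemma finite_T: "finite T" using T finite_subset by blast

lemma y_pm: "v < N \<Longrightarrow> y v = 1 \<or> y v = -1"
  using balanced_labelsD(1)[OF y] .

lemma card_outside:
  assumes "\<sigma> \<in> {-1, 1}"
  shows "card {v\<in>{..<N} - T. y v = \<sigma>} = n_out"
proof -
  have "{v\<in>{..<N} - T. y v = \<sigma>} = {v\<in>{..<N}. y v = \<sigma>} - {v\<in>T. y v = \<sigma>}" by auto
  moreover have "{v\<in>T. y v = \<sigma>} \<subseteq> {v\<in>{..<N}. y v = \<sigma>}" using T by auto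
  ultimately have "card {v\<in>{..<N} - T. y v = \<sigma>} = card {v\<in>{..<N}. y v = \<sigma>} - t"
    using finite_T card_T[OF assms] by (simp add: card_Diff_subset)
  then show ?thesis using balanced_labelsD(2)[OF y assms] by (simp add: n_out_def)
qed

lemma two_n_out_le: "2 * n_out \<le> N - 1"
  using t_pos by (auto simp: n_out_def)

lemma own_edges_subset: "own_edges u \<subseteq> E" by (auto simp: own_edges_def)

lemma own_edges_disjoint: "u \<noteq> v \<Longrightarrow> own_edges u \<inter> own_edges v = {}" by (auto simp: own_edges_def)

text \<open>An own edge of size \<open>l\<close> is \<open>u\<close> together with \<open>l - 1\<close> unmarked vertices of one class: the
  class of \<open>u\<close> if the edge is monochromatic, the opposite one otherwise. As \<open>T\<close> is
  balanced, both classes have the same number of unmarked vertices; this equality centres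
  the tilted log-likelihood ratio.\<close>

lemma card_own_edges:
  assumes u: "u \<in> T" and l: "l \<in> L"
  shows "card {e\<in>own_edges u. card e = l \<and> monochromatic y e = b} = n_out choose (l - 1)"
proof -
  define \<tau> where "\<tau> = (if b then y u else - y u)"
  define U where "U = {v\<in>{..<N} - T. y v = \<tau>}"
  have uN: "u < N" using u T by auto
  have \<tau>: "\<tau> \<in> {-1, 1}" using y_pm[OF uN] by (auto simp: \<tau>_def)
  have yu: "y u \<noteq> - y u" using y_pm[OF uN] by auto
  have cU: "card U = n_out" "finite U" using card_outside[OF \<tau>] by (auto simp: U_def)
  have "{e\<in>own_edges u. card e = l \<and> monochromatic y e = b} = insert u ` {f. f \<subseteq> U \<and> card f
    = l - 1}"
    (is "?C = ?I")
  proof (intro equalityI subsetI)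
    fix e assume "e \<in> ?C"
    then have e: "e \<subseteq> {..<N}" "e \<inter> T = {u}" "monochromatic y (e - {u})" "card e = l"
      "monochromatic y e = b" by (auto simp: own_edges_def potential_edges_def)
    have fin: "finite e" using e(1) finite_subset by blast
    have "e - {u} \<subseteq> U"
    proof
      fix a assume a: "a \<in> e - {u}"
      have "y a = \<tau>"
      proof (cases b)
        case True
        then show ?thesis using e a by (auto simp: monochromatic_def \<tau>_def)
      next
        case False
        have "y a \<noteq> y u"
        proof
          assume "y a = y u"
          moreover have "y v = y a" if "v \<in> e" "v \<noteq> u" for v
            using e(3) a that unfolding monochromatic_def by blast
          ultimately have "\<forall>v\<in>e. y v = y u" by metis
          then have "monochromatic y e" by (auto simp: monochromatic_def)
          then show False using False e by simp
        qed
        then show ?thesis using False a e(1) y_pm[of a] y_pm[OF uN] by (auto simp: \<tau>_def)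
      qed
      then show "a \<in> U" using a e by (auto simp: U_def)
    qed
    moreover have "card (e - {u}) = l - 1" using e fin by (auto simp: card_Diff_singleton_if)
    moreover have "e = insert u (e - {u})" using e by auto
    ultimately show "e \<in> ?I" by blast
  next
    fix e assume "e \<in> ?I"
    then obtain f where f: "f \<subseteq> U" "card f = l - 1" "e = insert u f" by auto
    have fin: "finite f" using f cU finite_subset by blast
    have uf: "u \<notin> f" using f u by (auto simp: U_def)
    have ce: "card e = l" using f fin uf L_ge_2[OF l] by auto
    have "f \<noteq> {}" using f(2) L_ge_2[OF l] by auto
    then obtain a where a: "a \<in> f" by auto
    have yf: "y v = \<tau>" if "v \<in> f" for v using f that by (auto simp: U_def)
    have "monochromatic y e = b"
      using yf a yu uf unfolding f(3) monochromatic_def by (auto simp: \<tau>_def split: if_splits)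
    moreover have "monochromatic y (e - {u})" using yf f(3) by (auto simp: monochromatic_def)
    ultimately show "e \<in> ?C"
      using f ce l uN u by (auto simp: own_edges_def potential_edges_def U_def)
  qed
  moreover have "inj_on (insert u) {f. f \<subseteq> U \<and> card f = l - 1}"
    using u by (intro inj_onI) (auto simp: U_def insert_eq_iff)
  ultimately show ?thesis
    using n_subsets[OF cU(2), of "l - 1"] cU(1) by (simp add: card_image)
qed

lemma sum_own_edges:
  assumes u: "u \<in> T"
  shows "(\<Sum>e\<in>own_edges u. g (monochromatic y e) (card e))
    = (\<Sum>l\<in>L. real (n_out choose (l - 1)) * (g True l + g False l))"
proof -
  have fin: "finite (own_edges u)" using own_edges_subset finite_E finite_subset by blast
  have "(\<Sum>e\<in>own_edges u. g (monochromatic y e) (card e))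
      = (\<Sum>k\<in>L \<times> UNIV. \<Sum>e\<in>{e\<in>own_edges u. (card e, monochromatic y e) = k}.
          g (monochromatic y e) (card e))"
    using fin finite_L
    by (subst sum.group[where g = "\<lambda>e. (card e, monochromatic y e)"])
       (auto simp: own_edges_def potential_edges_def)
  also have "\<dots> = (\<Sum>(l, b)\<in>L \<times> UNIV. real (n_out choose (l - 1)) * g b l)"
  proof (intro sum.cong refl, clarify)
    fix l b assume l: "l \<in> L"
    have "(\<Sum>e\<in>{e\<in>own_edges u. (card e, monochromatic y e)
      = (l, b)}. g (monochromatic y e) (card e))
      = (\<Sum>e\<in>{e\<in>own_edges u. card e = l \<and> monochromatic y e = b}. g b l)"
      by (intro sum.cong) auto
    then show "(\<Sum>e\<in>{e\<in>own_edges u. (card e, monochromatic y e)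
      = (l, b)}. g (monochromatic y e) (card e))
      = real (n_out choose (l - 1)) * g b l"
      using card_own_edges[OF u l] by simp
  qed
  also have "\<dots> = (\<Sum>l\<in>L. real (n_out choose (l - 1)) * (g True l + g False l))"
    by (simp add: sum.cartesian_product[symmetric] UNIV_bool distrib_left add.commute)
  finally show ?thesis .
qed

lemma sum_own_gap_le: "(\<Sum>l\<in>L. real (n_out choose (l - 1)) * hellinger_gap l) \<le> signal"
  unfolding signal_def
proof (rule sum_mono)
  fix l
  have "real ((n_out choose (l - 1)) * 2 ^ (l - 1)) \<le> real ((N - 1) choose (l - 1))"
    using binomial_half_le[OF two_n_out_le] of_nat_mono by blast
  then have "real (n_out choose (l - 1)) \<le> real ((N - 1) choose (l - 1)) / 2 ^ (l - 1)"
    by (simp add: field_simps)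
  then show "real (n_out choose (l - 1)) * hellinger_gap l
    \<le> real ((N - 1) choose (l - 1)) * hellinger_gap l / 2 ^ (l - 1)"
    using mult_right_mono hellinger_gap_nonneg by fastforce
qed

end

locale swapped_pair = marked_labels +
  fixes u w :: nat
  assumes u: "u \<in> T" and w: "w \<in> T" and opposite: "y u \<noteq> y w"
begin

abbreviation y' :: "nat \<Rightarrow> int" where "y' \<equiv> swap_labels u w y"

lemma uw_less: "u < N" "w < N" using u w T by auto

lemma u_neq_w: "u \<noteq> w" using opposite by auto

lemma monochromatic_swap_own:
  assumes "e \<in> own_edges u"
  shows "monochromatic y' e \<longleftrightarrow> \<not> monochromatic y e"
proof -
  have e: "e \<subseteq> {..<N}" "e \<inter> T = {u}" "monochromatic y (e - {u})" "card e \<in> L"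
    using assms by (auto simp: own_edges_def potential_edges_def)
  have fin: "finite e" using e(1) finite_subset by blast
  have "\<not> card e \<le> 1" using L_ge_2[OF e(4)] by simp
  then have "e \<noteq> {u}" by auto
  moreover have ue: "u \<in> e" using e(2) by auto
  ultimately obtain a where a: "a \<in> e" "a \<noteq> u"
    by (metis insertI1 singleton_iff subsetI subset_antisym)
  have wne: "w \<notin> e" using e(2) w u_neq_w by auto
  have mono: "y v = y a" if "v \<in> e" "v \<noteq> u" for v
    using e(3) that a unfolding monochromatic_def by (metis DiffI singletonD)
  have y'_eq: "y' v = (if v = u then y w else y v)" if "v \<in> e" for v
    using that wne by (auto simp: swap_labels_def)
  have "monochromatic y e \<longleftrightarrow> y a = y u"
  proof
    assume "monochromatic y e"
    then show "y a = y u" using a ue unfolding monochromatic_def by metis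
  next
    assume "y a = y u"
    then have "y v = y a" if "v \<in> e" for v using mono[OF that] by metis
    then show "monochromatic y e" unfolding monochromatic_def by metis
  qed
  moreover have "monochromatic y' e \<longleftrightarrow> y a = y w"
  proof
    assume "monochromatic y' e"
    then have "y' a = y' u" using a ue unfolding monochromatic_def by metis
    then show "y a = y w" using a ue y'_eq[of a] y'_eq[of u] by auto
  next
    assume "y a = y w"
    then have "y' v = y a" if "v \<in> e" for v using mono[OF that] y'_eq[OF that] by metis
    then show "monochromatic y' e" unfolding monochromatic_def by metis
  qed
  moreover have "a < N" using a e by auto
  ultimately show ?thesis using y_pm[of a] y_pm[OF uw_less(1)] y_pm[OF uw_less(2)] opposite
    by auto
qed

lemma edge_param_swap_own: "e \<in> own_edges u \<Longrightarrow> edge_param y' e = flipped_param e"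
  using monochromatic_swap_own by (auto simp: edge_param_def flipped_param_def)

lemma edge_param_swap_other:
  assumes "u \<notin> e" "w \<notin> e"
  shows "edge_param y' e = edge_param y e"
proof -
  have "y' v = y v" if "v \<in> e" for v using assms that by (auto simp: swap_labels_def)
  then have "monochromatic y' e = monochromatic y e"
    unfolding monochromatic_def by (intro ball_cong refl) simp
  then show ?thesis by (simp add: edge_param_def)
qed

text \<open>An edge that contains both \<open>u\<close> and \<open>w\<close> has two labels before and after the swap. So an
  affected edge contains exactly one of them, and if it is no own edge, it contains a
  further marked vertex.\<close>

lemma edge_param_swap_other_edges:
  assumes e: "e \<in> other_edges" and neq: "edge_param y' e \<noteq> edge_param y e"
  shows "\<exists>a\<in>{u, w}. \<exists>b\<in>T - {a}. a \<in> e \<and> b \<in> e"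
proof -
  have eE: "e \<in> E" using e by (auto simp: other_edges_def)
  have mneq: "monochromatic y' e \<noteq> monochromatic y e" using neq unfolding edge_param_def by metis
  have "u \<in> e \<or> w \<in> e" using edge_param_swap_other neq by blast
  moreover have "\<not> (u \<in> e \<and> w \<in> e)"
  proof
    assume uw: "u \<in> e \<and> w \<in> e"
    have "\<not> monochromatic y e" using uw opposite by (auto simp: monochromatic_def)
    moreover have "\<not> monochromatic y' e"
    proof
      assume "monochromatic y' e"
      then have "y' u = y' w" using uw unfolding monochromatic_def by blast
      then show False using opposite u_neq_w by (simp add: swap_labels_def)
    qed
    ultimately show False using mneq by simp
  qed
  moreover have "\<exists>b\<in>T - {a}. b \<in> e" if a: "a \<in> e" "a \<in> {u, w}" "{u, w} \<inter> e = {a}" for a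
  proof (rule ccontr)
    assume "\<not> (\<exists>b\<in>T - {a}. b \<in> e)"
    then have "e \<inter> T = {a}" using a u w by auto
    have "\<forall>v\<in>e - {a}. y' v = y v" using a by (auto simp: swap_labels_def)
    then have "monochromatic y (e - {a}) = monochromatic y' (e - {a})"
      unfolding monochromatic_def by (intro ball_cong refl) simp
    moreover have "monochromatic y e \<or> monochromatic y' e" using mneq by auto
    moreover have "monochromatic z (e - {a})" if "monochromatic z e" for z
      using that unfolding monochromatic_def by blast
    ultimately have "monochromatic y (e - {a})" by blast
    with \<open>e \<inter> T = {a}\<close> have "e \<in> own_edges a" using eE by (simp add: own_edges_def)
    then show False using e a u w by (auto simp: other_edges_def)
  qed
  ultimately show ?thesis by blast
qed

end


section \<open>Many independent events, and pairs of them\<close>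

text \<open>Chebyshev's inequality for the number of events that occur. Its variance is at most its
  mean \<open>\<mu>\<close>, and a deviation by \<open>\<mu> / 2\<close> therefore has probability at most \<open>4 / \<mu>\<close>.\<close>

lemma many_events_occur:
  fixes p :: "'e \<Rightarrow> real" and Q :: "'i \<Rightarrow> 'e set \<Rightarrow> bool" and \<pi> :: real
  assumes E: "finite E" and p: "\<And>e. e \<in> E \<Longrightarrow> 0 \<le> p e \<and> p e \<le> 1"
    and I: "finite I" "I \<noteq> {}" and A: "\<And>i. i \<in> I \<Longrightarrow> A i \<subseteq> E"
    and disj: "\<And>i j. i \<in> I \<Longrightarrow> j \<in> I \<Longrightarrow> i \<noteq> j \<Longrightarrow> A i \<inter> A j = {}"
    and Q: "\<And>i X. i \<in> I \<Longrightarrow> X \<subseteq> E \<Longrightarrow> Q i X = Q i (X \<inter> A i)"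
    and lower: "\<And>i. i \<in> I \<Longrightarrow> \<pi> \<le> subset_mean p E (\<lambda>X. of_bool (Q i X))" and \<pi>: "0 < \<pi>"
  shows "subset_mean p E (\<lambda>X. of_bool (real (card {i\<in>I. Q i X}) < card I * \<pi> / 2))
    \<le> 4 / (card I * \<pi>)"
proof -
  define m where "m i = subset_mean p E (\<lambda>X. of_bool (Q i X))" for i
  define \<mu> where "\<mu> = sum m I"
  define f where "f i X = of_bool (Q i X) - m i" for i X
  have lm: "card I * \<pi> \<le> \<mu>"
    unfolding \<mu>_def using lower sum_bounded_below[of I \<pi> m] by (simp add: m_def)
  have pos: "0 < card I * \<pi>" using I \<pi> by (simp add: card_gt_0_iff)
  then have \<mu>: "0 < \<mu>" using lm by simp
  have subset_mean_f: "subset_mean p E (f i) = 0" for i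
    using subset_mean_add[of p E "\<lambda>X. of_bool (Q i X)" "\<lambda>_. - m i"] E
      by (simp add: subset_mean_const f_def[abs_def] m_def)
  have subset_mean_f2: "subset_mean p E (\<lambda>X. (f i X)\<^sup>2) \<le> m i" for i
  proof -
    have "(f i X)\<^sup>2 = (1 - 2 * m i) * of_bool (Q i X) + (m i)\<^sup>2" for X
      by (simp add: f_def power2_eq_square algebra_simps)
    then have "subset_mean p E (\<lambda>X. (f i X)\<^sup>2) = (1 - 2 * m i) * m i + (m i)\<^sup>2"
      using E by (simp add: subset_mean_add subset_mean_cmult subset_mean_const m_def)
    also have "\<dots> = m i - (m i)\<^sup>2" by (simp add: power2_eq_square algebra_simps)
    finally show ?thesis by simp
  qed
  have "subset_mean p E (\<lambda>X. of_bool (real (card {i\<in>I. Q i X}) < card I * \<pi> / 2))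
      \<le> subset_mean p E (\<lambda>X. (4 / \<mu>\<^sup>2) * (\<Sum>i\<in>I. f i X)\<^sup>2)"
  proof (rule subset_mean_mono[OF p])
    fix X
    have "(\<Sum>i\<in>I. f i X) = real (card {i\<in>I. Q i X}) - \<mu>"
      unfolding f_def sum_subtractf \<mu>_def
        using I(1) by (simp add: of_bool_def sum.If_cases Int_def)
    moreover have "1 \<le> (4 / \<mu>\<^sup>2) * (c - \<mu>)\<^sup>2" if "c < card I * \<pi> / 2" for c :: real
    proof -
      have "\<mu> / 2 \<le> \<mu> - c" using that lm by simp
      then have "(\<mu> / 2)\<^sup>2 \<le> (\<mu> - c)\<^sup>2" using \<mu> by (intro power_mono) auto
      then show ?thesis using \<mu> by (simp add: field_simps power2_commute)
    qed
    ultimately show "of_bool (real (card {i\<in>I. Q i X}) < card I * \<pi> / 2)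
        \<le> (4 / \<mu>\<^sup>2) * (\<Sum>i\<in>I. f i X)\<^sup>2"
      by (simp add: of_bool_def)
  qed
  also have "\<dots> = (4 / \<mu>\<^sup>2) * (\<Sum>i\<in>I. subset_mean p E (\<lambda>X. (f i X)\<^sup>2))"
    unfolding subset_mean_cmult
  proof (subst subset_mean_square_sum[OF I(1)])
    fix i j assume ij: "i \<in> I" "j \<in> I" "i \<noteq> j"
    have "subset_mean p E (\<lambda>X. f i X * f j X) = subset_mean p E (f i) * subset_mean p E (f j)"
      by (rule subset_mean_mult[OF E A A disj]) (use ij Q in \<open>auto simp: f_def\<close>)
    then show "subset_mean p E (\<lambda>X. f i X * f j X) = 0" using subset_mean_f by simp
  qed simp
  also have "\<dots> \<le> (4 / \<mu>\<^sup>2) * \<mu>"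
    unfolding \<mu>_def by (intro mult_left_mono sum_mono subset_mean_f2) simp
  also have "\<dots> = 4 / \<mu>" using \<mu> by (simp add: power2_eq_square)
  also have "\<dots> \<le> 4 / (card I * \<pi>)" using lm pos by (intro divide_left_mono) auto
  finally show ?thesis .
qed

text \<open>The sets of indices with \<open>P\<close> and with \<open>Q\<close> are random but depend on \<open>A\<close> only, whereas a
  pair fails according to the independent part \<open>B\<close>. Choosing one index \<open>i0\<close> with \<open>P\<close>, on
  average at most a fraction \<open>\<rho>\<close> of its partners fail, so by Markov's inequality more than
  half of them fail with probability at most \<open>2 * \<rho>\<close>. No size of the index sets enters the
  bound, which is why a mere \<open>\<rho> = o(1)\<close> suffices although there are polynomially many
  pairs.\<close>

lemma random_pair_survives:
  fixes p :: "'e \<Rightarrow> real" and P Q :: "'i \<Rightarrow> 'e set \<Rightarrow> bool" and F :: "'i \<Rightarrow> 'i \<Rightarrow> 'e set \<Rightarrow> bool"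
  assumes E: "finite E" and p: "\<And>e. e \<in> E \<Longrightarrow> 0 \<le> p e \<and> p e \<le> 1"
    and IJ: "finite I" "finite J" and AB: "A \<subseteq> E" "B \<subseteq> E" "A \<inter> B = {}"
    and P: "\<And>i X. i \<in> I \<Longrightarrow> X \<subseteq> E \<Longrightarrow> P i X = P i (X \<inter> A)"
    and Q: "\<And>j X. j \<in> J \<Longrightarrow> X \<subseteq> E \<Longrightarrow> Q j X = Q j (X \<inter> A)"
    and F: "\<And>i j X. i \<in> I \<Longrightarrow> j \<in> J \<Longrightarrow> X \<subseteq> E \<Longrightarrow> F i j X = F i j (X \<inter> B)"
    and rare: "\<And>i j. i \<in> I \<Longrightarrow> j \<in> J \<Longrightarrow> subset_mean p E (\<lambda>X. of_bool (F i j X)) \<le> \<rho>" and \<rho>: "0 \<le> \<rho>"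
  shows "subset_mean p E (\<lambda>X. of_bool ((\<exists>i\<in>I. P i X) \<and>
      (\<forall>i\<in>I. P i X \<longrightarrow> 2 * card {j\<in>J. Q j X \<and> \<not> F i j X} < card {j\<in>J. Q j X}))) \<le> 2 * \<rho>"
proof -
  define i0 where "i0 X = (SOME i. i \<in> I \<and> P i X)" for X
  define q where "q X = {j\<in>J. Q j X}" for X
  \<comment> \<open>The weights \<open>c i j\<close> describe a uniformly chosen partner \<open>j\<close> of \<open>i0\<close>; they are
    functions of \<open>A\<close>, hence independent of the failures.\<close>
  define c where "c i j X = of_bool (i0 X = i \<and> P i X \<and> Q j X) / real (card (q X))" for i j X
  have q: "q X = q (X \<inter> A)" if "X \<subseteq> E" for X using Q that by (auto simp: q_def)
  have i0: "i0 X = i0 (X \<inter> A)" if "X \<subseteq> E" for X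
    unfolding i0_def by (intro arg_cong[where f = Eps] ext) (use P that in auto)
  have c_nonneg: "0 \<le> c i j X" for i j X by (simp add: c_def)
  have c_sum: "(\<Sum>i\<in>I. \<Sum>j\<in>J. c i j X) \<le> 1" for X
  proof -
    have "(\<Sum>j\<in>J. c i j X) \<le> of_bool (i = i0 X)" for i
    proof -
      have "(\<Sum>j\<in>J. c i j X) = of_bool (i0 X
        = i \<and> P i X) * (\<Sum>j\<in>J. of_bool (Q j X)) / real (card (q X))"
        unfolding c_def sum_divide_distrib sum_distrib_left by (intro sum.cong) auto
      also have "(\<Sum>j\<in>J. of_bool (Q j X) :: real) = real (card (q X))"
        using IJ by (simp add: q_def of_bool_def sum.If_cases Int_def)
      finally show ?thesis by auto
    qed
    then have "(\<Sum>i\<in>I. \<Sum>j\<in>J. c i j X) \<le> (\<Sum>i\<in>I. of_bool (i = i0 X))" by (intro sum_mono)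
    also have "\<dots> \<le> 1" using IJ by (simp add: of_bool_def)
    finally show ?thesis .
  qed
  have "subset_mean p E (\<lambda>X. of_bool ((\<exists>i\<in>I. P i X) \<and>
      (\<forall>i\<in>I. P i X \<longrightarrow> 2 * card {j\<in>J. Q j X \<and> \<not> F i j X} < card {j\<in>J. Q j X})))
    \<le> subset_mean p E (\<lambda>X. 2 * (\<Sum>i\<in>I. \<Sum>j\<in>J. c i j X * of_bool (F i j X)))"
  proof (rule subset_mean_mono[OF p])
    fix X
    let ?bad = "(\<exists>i\<in>I. P i X) \<and>
      (\<forall>i\<in>I. P i X \<longrightarrow> 2 * card {j\<in>J. Q j X \<and> \<not> F i j X} < card {j\<in>J. Q j X})"
    have nonneg: "0 \<le> (\<Sum>j\<in>J. c i j X * of_bool (F i j X))" for i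
      using c_nonneg by (intro sum_nonneg) auto
    show "of_bool ?bad \<le> 2 * (\<Sum>i\<in>I. \<Sum>j\<in>J. c i j X * of_bool (F i j X))"
    proof (cases ?bad)
      case True
      have ex: "i0 X \<in> I \<and> P (i0 X) X"
        unfolding i0_def by (rule someI_ex) (use True in auto)
      define g b where "g = card {j\<in>J. Q j X \<and> \<not> F (i0 X) j X}"
        and "b = card {j\<in>J. Q j X \<and> F (i0 X) j X}"
      have "2 * g < card (q X)" using True ex by (auto simp: g_def q_def)
      moreover have "card (q X) = g + b"
        unfolding g_def b_def q_def
          using IJ by (subst card_Un_disjoint[symmetric]) (auto intro: arg_cong[where f = card])
      ultimately have gb: "0 < card (q X)" "real (card (q X)) < 2 * real b" by auto
      have "(\<Sum>j\<in>J. c (i0 X) j X * of_bool (F (i0 X) j X))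
          = (\<Sum>j\<in>J. of_bool (Q j X \<and> F (i0 X) j X)) / card (q X)"
        unfolding c_def sum_divide_distrib using ex by (intro sum.cong) auto
      also have "(\<Sum>j\<in>J. of_bool (Q j X \<and> F (i0 X) j X) :: real) = real b"
        using IJ by (simp add: b_def of_bool_def sum.If_cases Int_def)
      finally have "2 * (\<Sum>j\<in>J. c (i0 X) j X * of_bool (F (i0 X) j X)) = 2 * (real b / card (q X))"
        by simp
      moreover have "1 \<le> 2 * (real b / card (q X))" using gb by (simp add: field_simps)
      ultimately have "1 \<le> 2 * (\<Sum>j\<in>J. c (i0 X) j X * of_bool (F (i0 X) j X))" by simp
      also have "\<dots> \<le> 2 * (\<Sum>i\<in>I. \<Sum>j\<in>J. c i j X * of_bool (F i j X))"
        using ex IJ nonneg by (intro mult_left_mono member_le_sum[of "i0 X"]) auto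
      finally show ?thesis using True by simp
    next
      case False
      then show ?thesis using nonneg by (simp only: of_bool_eq) (simp add: sum_nonneg)
    qed
  qed
  also have "\<dots> = 2 * (\<Sum>i\<in>I. \<Sum>j\<in>J. subset_mean p E (\<lambda>X. c i j X * of_bool (F i j X)))"
    by (simp add: subset_mean_cmult subset_mean_sum)
  also have "\<dots> \<le> 2 * (\<Sum>i\<in>I. \<Sum>j\<in>J. subset_mean p E (c i j) * \<rho>)"
  proof (intro mult_left_mono sum_mono)
    fix i j assume ij: "i \<in> I" "j \<in> J"
    have "subset_mean p E (\<lambda>X. c i j X * of_bool (F i j X))
      = subset_mean p E (c i j) * subset_mean p E (\<lambda>X. of_bool (F i j X))"
    proof (rule subset_mean_mult[OF E AB])
      fix X assume X: "X \<subseteq> E"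
      show "c i j X = c i j (X \<inter> A)"
        unfolding c_def i0[OF X, symmetric] q[OF X, symmetric] P[OF ij(1) X, symmetric]
          Q[OF ij(2) X, symmetric] ..
      show "of_bool (F i j X) = (of_bool (F i j (X \<inter> B)) :: real)" using F[OF ij X] by simp
    qed
    also have "\<dots> \<le> subset_mean p E (c i j) * \<rho>"
    proof (intro mult_left_mono rare ij)
      have "subset_mean p E (\<lambda>_. 0) \<le> subset_mean p E (c i j)"
        by (rule subset_mean_mono[OF p]) (auto simp: c_nonneg)
      then show "0 \<le> subset_mean p E (c i j)" using E by (simp add: subset_mean_const)
    qed
    finally show "subset_mean p E (\<lambda>X. c i j X * of_bool (F i j X))
      \<le> subset_mean p E (c i j) * \<rho>" .
  qed simp
  also have "\<dots> = 2 * (subset_mean p E (\<lambda>X. \<Sum>i\<in>I. \<Sum>j\<in>J. c i j X) * \<rho>)"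
    by (simp add: subset_mean_sum sum_distrib_right)
  also have "\<dots> \<le> 2 * (subset_mean p E (\<lambda>_. 1) * \<rho>)"
    using \<rho> c_sum by (intro mult_left_mono mult_right_mono subset_mean_mono p) auto
  finally show ?thesis using E by (simp add: subset_mean_const)
qed


context block_model
begin

section \<open>Edges with two marked vertices\<close>

text \<open>Up to a constant, the squared Hellinger distance carried by the edges through two given
  vertices.\<close>

definition pair_gap :: real where
  "pair_gap = (\<Sum>l\<in>L. real ((N - 2) choose (l - 2)) * hellinger_gap l)"

lemma pair_gap_nonneg: "0 \<le> pair_gap"
  unfolding pair_gap_def by (intro sum_nonneg) (auto simp: hellinger_gap_nonneg)

lemma bernoulli_params: "l \<in> L \<Longrightarrow> 0 < \<beta> l \<and> \<beta> l < 1 \<and> 0 < \<alpha> l \<and> \<alpha> l < 1"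
  using beta_pos[of l] beta_le_alpha[of l] alpha_le[of l] s_le by auto

lemma card_edges_through_pair:
  assumes ab: "a < N" "b < N" "a \<noteq> b" and l: "l \<in> L"
  shows "card {e\<in>E. card e = l \<and> a \<in> e \<and> b \<in> e} = (N - 2) choose (l - 2)"
proof -
  define V where "V = {..<N} - {a, b}"
  have V: "finite V" "card V = N - 2" using ab by (auto simp: V_def card_Diff_subset)
  have "{e\<in>E. card e = l \<and> a \<in> e \<and> b \<in> e} = (\<lambda>f. insert a (insert b f)) ` {f. f \<subseteq> V \<and> card f
    = l - 2}"
    (is "?C = ?I")
  proof (intro equalityI subsetI)
    fix e assume "e \<in> ?C"
    then have e: "e \<subseteq> {..<N}" "card e = l" "a \<in> e" "b \<in> e" by (auto simp: potential_edges_def)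
    then have "finite e" using finite_subset by blast
    then have "card (e - {a, b}) = l - 2" using e ab by (simp add: card_Diff_subset)
    moreover have "e - {a, b} \<subseteq> V" using e by (auto simp: V_def)
    moreover have "e = insert a (insert b (e - {a, b}))" using e by auto
    ultimately show "e \<in> ?I" by blast
  next
    fix e assume "e \<in> ?I"
    then obtain f where f: "f \<subseteq> V" "card f = l - 2" "e = insert a (insert b f)" by auto
    have "finite f" using f V finite_subset by blast
    moreover have "a \<notin> f" "b \<notin> f" using f by (auto simp: V_def)
    ultimately have "card e = l" using f ab L_ge_2[OF l] by simp
    moreover have "e \<subseteq> {..<N}" using f ab by (auto simp: V_def)
    ultimately show "e \<in> ?C" using l f by (auto simp: potential_edges_def)
  qed
  moreover have "inj_on (\<lambda>f. insert a (insert b f)) {f. f \<subseteq> V \<and> card f = l - 2}"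
  proof (rule inj_onI)
    fix f g assume "f \<in> {f. f \<subseteq> V \<and> card f = l - 2}" "g \<in> {f. f \<subseteq> V \<and> card f = l - 2}"
      and eq: "insert a (insert b f) = insert a (insert b g)"
    then have "f = insert a (insert b f) - {a, b}" "g = insert a (insert b g) - {a, b}"
      by (auto simp: V_def)
    then show "f = g" using eq by metis
  qed
  ultimately show ?thesis using n_subsets[OF V(1), of "l - 2"] V(2) by (simp add: card_image)
qed

lemma sum_edges_through_pair:
  assumes ab: "a < N" "b < N" "a \<noteq> b"
  shows "(\<Sum>e\<in>E. of_bool (a \<in> e \<and> b \<in> e) * hellinger_gap (card e)) = pair_gap"
proof -
  have "(\<Sum>e\<in>E. of_bool (a \<in> e \<and> b \<in> e) * hellinger_gap (card e))
      = (\<Sum>l\<in>L. \<Sum>e\<in>{e\<in>E. card e = l}. of_bool (a \<in> e \<and> b \<in> e) * hellinger_gap (card e))"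
    by (rule sum.group[symmetric]) (auto simp: finite_E finite_L potential_edges_def)
  also have "\<dots> = pair_gap"
    unfolding pair_gap_def
  proof (intro sum.cong refl)
    fix l assume l: "l \<in> L"
    have "(\<Sum>e\<in>{e\<in>E. card e = l}. of_bool (a \<in> e \<and> b \<in> e) * hellinger_gap (card e))
        = (\<Sum>e\<in>{e\<in>E. card e = l \<and> a \<in> e \<and> b \<in> e}. hellinger_gap l)"
      using finite_E by (intro sum.mono_neutral_cong_right) auto
    then show "(\<Sum>e\<in>{e\<in>E. card e = l}. of_bool (a \<in> e \<and> b \<in> e) * hellinger_gap (card e))
        = real ((N - 2) choose (l - 2)) * hellinger_gap l"
      using card_edges_through_pair[OF ab l] by simp
  qed
  finally show ?thesis .
qed

text \<open>Two given vertices share about the part \<open>1 / N\<close> of the edges at one of them.\<close>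

lemma pair_gap_le: "real (N - 1) * pair_gap \<le> (\<Sum>l\<in>L. real (l - 1) * 2 ^ (l - 1)) * signal"
  unfolding pair_gap_def sum_distrib_left sum_distrib_right
proof (rule sum_mono)
  fix l assume l: "l \<in> L"
  obtain k where k: "l = Suc (Suc k)" using L_ge_2[OF l] by (metis add_2_eq_Suc le_Suc_ex)
  have "(N - 1) * ((N - 2) choose (l - 2)) = (l - 1) * ((N - 1) choose (l - 1))"
    using binomial_absorption[of k "N - 1"] by (simp add: k numeral_2_eq_2)
  then have absorb: "real (N - 1) * real ((N - 2) choose (l - 2))
    = real (l - 1) * real ((N - 1) choose (l - 1))"
    by (metis of_nat_mult)
  have "real ((N - 1) choose (l - 1)) * hellinger_gap l / 2 ^ (l - 1) \<le> signal"
    unfolding signal_def using l finite_L hellinger_gap_nonneg by (intro member_le_sum) auto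
  then have "real (l - 1) * (real ((N - 1) choose (l - 1)) * hellinger_gap l)
    \<le> real (l - 1) * (2 ^ (l - 1) * signal)"
    by (intro mult_left_mono) (auto simp: field_simps)
  then show "real (N - 1) * (real ((N - 2) choose (l - 2)) * hellinger_gap l)
    \<le> real (l - 1) * 2 ^ (l - 1) * signal"
    using absorb by (metis mult.assoc)
qed

end

context swapped_pair
begin

text \<open>There are two choices for the swapped vertex in the edge and at most \<open>2 * t\<close> for the
  second marked one.\<close>

lemma sum_other_edges_le:
  "(\<Sum>e\<in>other_edges. 1 - bhattacharyya (edge_param y e) (edge_param y' e)) \<le> 4 * real t * pair_gap"
proof -
  have "(\<Sum>e\<in>other_edges. 1 - bhattacharyya (edge_param y e) (edge_param y' e))
      \<le> (\<Sum>e\<in>other_edges. \<Sum>a\<in>{u, w}. \<Sum>b\<in>T - {a}. of_bool (a \<in> e \<and> b \<in> e) * hellinger_gap (card e))"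
  proof (rule sum_mono)
    fix e assume e: "e \<in> other_edges"
    then have eE: "e \<in> E" by (auto simp: other_edges_def)
    then have l: "card e \<in> L" by (simp add: potential_edges_def)
    have nonneg: "0 \<le> (\<Sum>b\<in>T - {a}. of_bool (a \<in> e \<and> b \<in> e) * hellinger_gap (card e))" for a
      by (intro sum_nonneg) (auto simp: hellinger_gap_nonneg)
    show "1 - bhattacharyya (edge_param y e) (edge_param y' e)
        \<le> (\<Sum>a\<in>{u, w}. \<Sum>b\<in>T - {a}. of_bool (a \<in> e \<and> b \<in> e) * hellinger_gap (card e))"
    proof (cases "edge_param y' e = edge_param y e")
      case True
      then have "1 - bhattacharyya (edge_param y e) (edge_param y' e) = 0"
        using edge_param_bounds[OF eE, of y] by (simp add: bhattacharyya_same)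
      then show ?thesis using nonneg by (simp add: sum_nonneg del: sum.insert)
    next
      case False
      then have "bhattacharyya (edge_param y e) (edge_param y' e)
        = bhattacharyya (\<alpha> (card e)) (\<beta> (card e))"
        by (auto simp: edge_param_def bhattacharyya_commute split: if_splits)
      then have "1 - bhattacharyya (edge_param y e) (edge_param y' e)
        \<le> hellinger_gap (card e) / (2 * (1 - s))"
        using one_minus_bhattacharyya_le[OF beta_pos[OF l] beta_le_alpha[OF l] alpha_le[OF l]
          s_le] by (simp add: hellinger_gap_def)
      also have "\<dots> \<le> hellinger_gap (card e) / 1"
        using s_le by (intro divide_left_mono hellinger_gap_nonneg) auto
      finally have le: "1 - bhattacharyya (edge_param y e) (edge_param y' e)
        \<le> hellinger_gap (card e)" by simp
      obtain a b where ab: "a \<in> {u, w}" "b \<in> T - {a}" "a \<in> e" "b \<in> e"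
        using edge_param_swap_other_edges[OF e False] by blast
      have "hellinger_gap (card e) = of_bool (a \<in> e \<and> b \<in> e) * hellinger_gap (card e)"
        using ab by simp
      also have "\<dots> \<le> (\<Sum>b\<in>T - {a}. of_bool (a \<in> e \<and> b \<in> e) * hellinger_gap (card e))"
        using ab(2) finite_T hellinger_gap_nonneg by (intro member_le_sum) auto
      also have "\<dots> \<le> (\<Sum>a\<in>{u, w}. \<Sum>b\<in>T - {a}. of_bool (a \<in> e \<and> b \<in> e) * hellinger_gap (card e))"
        using ab(1) nonneg by (intro member_le_sum) auto
      finally show ?thesis using le by simp
    qed
  qed
  also have "\<dots> \<le> (\<Sum>e\<in>E. \<Sum>a\<in>{u, w}. \<Sum>b\<in>T - {a}. of_bool (a \<in> e \<and> b \<in> e) * hellinger_gap (card e))"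
    using finite_E hellinger_gap_nonneg
      by (intro sum_mono2) (auto simp: other_edges_def intro!: sum_nonneg add_nonneg_nonneg)
  also have "\<dots> = (\<Sum>a\<in>{u, w}. \<Sum>b\<in>T - {a}. \<Sum>e\<in>E. of_bool (a \<in> e \<and> b \<in> e) * hellinger_gap (card e))"
    by (subst sum.swap, intro sum.cong refl, subst sum.swap) simp
  also have "\<dots> = (\<Sum>a\<in>{u, w}. \<Sum>b\<in>T - {a}. pair_gap)"
    using T uw_less by (intro sum.cong refl sum_edges_through_pair) auto
  also have "\<dots> \<le> (\<Sum>a\<in>{u, w}. real (2 * t) * pair_gap)"
  proof (rule sum_mono)
    fix a
    have "y v = 1 \<or> y v = -1" if "v \<in> T" for v using that y_pm T by auto
    then have "card T = 2 * t"
      using sum_pm_one(2)[OF finite_T, of y] card_T[of 1] card_T[of "-1"] by simp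
    then have "card (T - {a}) \<le> 2 * t" by (metis card_Diff1_le finite_T)
    then show "(\<Sum>b\<in>T - {a}. pair_gap) \<le> real (2 * t) * pair_gap"
      using pair_gap_nonneg by (simp add: mult_right_mono)
  qed
  also have "\<dots> = 4 * real t * pair_gap" using u_neq_w by simp
  finally show ?thesis .
qed

lemma other_edges_ratio_rarely_small:
  "subset_mean (edge_param y) E
    (\<lambda>X. of_bool (subset_weight (edge_param y') other_edges X < subset_weight
    (edge_param y) other_edges X / 4)) \<le> 32 * real t * pair_gap"
proof -
  have sub: "other_edges \<subseteq> E" by (auto simp: other_edges_def)
  then have fin: "finite other_edges" using finite_E finite_subset by blast
  have "subset_mean (edge_param y) E
    (\<lambda>X. of_bool (subset_weight (edge_param y') other_edges X < subset_weight
    (edge_param y) other_edges X / 4))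
      = subset_mean (edge_param y) other_edges
        (\<lambda>X. of_bool (subset_weight (edge_param y') other_edges X < subset_weight
        (edge_param y) other_edges X / 4))"
  proof (rule subset_mean_restrict[OF finite_E sub])
    fix X
    have "subset_weight p other_edges X = subset_weight p other_edges (X \<inter> other_edges)" for p
      by (rule subset_weight_cong) auto
    then show "of_bool (subset_weight (edge_param y') other_edges X < subset_weight
      (edge_param y) other_edges X / 4)
      = (of_bool (subset_weight (edge_param y') other_edges (X \<inter> other_edges) < subset_weight
        (edge_param y) other_edges (X \<inter> other_edges) / 4) :: real)" by simp
  qed
  also have "\<dots> \<le> 8 * (\<Sum>e\<in>other_edges. 1 - bhattacharyya (edge_param y e) (edge_param y' e))"
    using sub edge_param_bounds by (intro likelihood_ratio_small fin) auto
  finally show ?thesis using sum_other_edges_le by simp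
qed

text \<open>The weights factor over the own edges of \<open>u\<close>, those of \<open>w\<close>, the own edges of other
  marked vertices, where the swap changes nothing, and the remaining edges.\<close>

lemma swap_weight_ge:
  assumes X: "subset_weight (edge_param y) other_edges X / 4
    \<le> subset_weight (edge_param y') other_edges X"
    and u_bad: "exp (- 2 * x) * subset_weight (edge_param y) (own_edges u) X
      \<le> subset_weight flipped_param (own_edges u) X"
    and w_bad: "exp (- 2 * x) * subset_weight (edge_param y) (own_edges w) X
      \<le> subset_weight flipped_param (own_edges w) X"
  shows "exp (- 4 * x) / 4 * subset_weight (edge_param y) E X \<le> subset_weight (edge_param y') E X"
proof -
  have pos: "0 < subset_weight (edge_param z) F X" if "F \<subseteq> E" for F z
    using that edge_param_bounds by (intro subset_weight_pos) auto
  have fin: "finite F" if "F \<subseteq> E" for F using that finite_E finite_subset by blast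
  define R where "R = (\<Union>v\<in>T - {u, w}. own_edges v)"
  have RE: "R \<subseteq> E" "other_edges \<subseteq> E" using own_edges_subset by (auto simp: R_def other_edges_def)
  have split: "E = (own_edges u \<union> own_edges w) \<union> (R \<union> other_edges)"
    using own_edges_subset u w by (auto simp: R_def other_edges_def)
  have disj: "(own_edges u \<union> own_edges w) \<inter> (R \<union> other_edges) = {}" "R \<inter> other_edges = {}"
    using own_edges_disjoint u w by (auto simp: R_def other_edges_def own_edges_def)
  have factor: "subset_weight p E X
    = (subset_weight p (own_edges u) X * subset_weight p (own_edges w) X) * (subset_weight p R X
    * subset_weight p other_edges X)" for p
    unfolding split using own_edges_disjoint[OF u_neq_w] disj RE own_edges_subset
    by (simp add: subset_weight_Un fin)
  interpret sw: swapped_pair N L \<alpha> \<beta> s y T t w u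
    using u w opposite by unfold_locales auto
  have "subset_weight (edge_param y') (own_edges u) X
    = subset_weight flipped_param (own_edges u) X" "subset_weight (edge_param y') (own_edges w) X
    = subset_weight flipped_param (own_edges w) X"
    using edge_param_swap_own sw.edge_param_swap_own swap_labels_commute[of w u y]
      by (auto intro: subset_weight_cong)
  moreover have "subset_weight (edge_param y') R X = subset_weight (edge_param y) R X"
  proof (intro subset_weight_cong edge_param_swap_other)
    fix e assume "e \<in> R"
    then obtain v where v: "v \<in> T" "v \<noteq> u" "v \<noteq> w" "e \<inter> T = {v}"
      by (auto simp: R_def own_edges_def)
    then show "u \<notin> e" "w \<notin> e" using u w by auto
  qed simp
  ultimately have y'_factor: "subset_weight (edge_param y') E X
      = (subset_weight flipped_param (own_edges u) X
        * subset_weight flipped_param (own_edges w) X) * (subset_weight (edge_param y) R X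
        * subset_weight (edge_param y') other_edges X)"
    using factor[of "edge_param y'"] by simp
  have flip_nonneg: "0 \<le> subset_weight flipped_param (own_edges u) X" "0
    \<le> subset_weight flipped_param (own_edges w) X"
    using u_bad w_bad pos[OF own_edges_subset] by (smt (verit) exp_gt_zero mult_pos_pos)+
  have "exp (- 4 * x) / 4 * subset_weight (edge_param y) E X
      = ((exp (- 2 * x) * subset_weight (edge_param y) (own_edges u) X) * (exp (- 2 * x)
        * subset_weight (edge_param y) (own_edges w) X))
        * (subset_weight (edge_param y) R X * (subset_weight (edge_param y) other_edges X / 4))"
    unfolding factor[of "edge_param y"] by (simp add: exp_add[symmetric] mult_ac)
  also have "\<dots> \<le> (subset_weight flipped_param (own_edges u) X
    * subset_weight flipped_param (own_edges w) X) * (subset_weight (edge_param y) R X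
    * subset_weight (edge_param y') other_edges X)"
    by (intro mult_mono X u_bad w_bad order.refl mult_nonneg_nonneg)
      (use flip_nonneg pos[OF own_edges_subset] pos[OF RE(1)] pos[OF RE(2)] in \<open>auto intro:
        less_imp_le\<close>)
  finally show ?thesis unfolding y'_factor .
qed

end


context block_model
begin

section \<open>Flippable vertices\<close>

text \<open>The lower bound for the probability that a marked vertex is flippable with tolerance
  \<open>2 * x\<close>: the affinity, the cost \<open>exp (- x)\<close> of the change of measure, and \<open>1 / 2\<close> from
  Chebyshev's inequality.\<close>

definition flip_prob :: "real \<Rightarrow> real" where
  "flip_prob x = exp (- (signal / (1 - s)\<^sup>2) - x) / 2"

lemma flip_prob_pos: "0 < flip_prob x" by (simp add: flip_prob_def)

text \<open>One fixed vertex \<open>u\<close> of label \<open>\<sigma>\<close> with many partners. The asymmetric form is what the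
  counting argument for unbalanced estimates needs.\<close>

definition swappable :: "real \<Rightarrow> real \<Rightarrow> int \<Rightarrow> (nat \<Rightarrow> int) \<Rightarrow> nat set set \<Rightarrow> bool" where
  "swappable x M \<sigma> y X \<longleftrightarrow> (\<exists>u<N. y u = \<sigma> \<and>
     M \<le> card {w\<in>{..<N}. y w = - \<sigma> \<and> exp (- 4 * x) / 4 * subset_weight (edge_param y) E X
       \<le> subset_weight (edge_param (swap_labels u w y)) E X})"

end

context marked_labels
begin

lemma prod_bhattacharyya_own:
  assumes v: "v \<in> T"
  shows "exp (- (signal / (1 - s)\<^sup>2))
    \<le> (\<Prod>e\<in>own_edges v. bhattacharyya (edge_param y e) (flipped_param e))"
proof -
  have bp: "0 < bhattacharyya (edge_param y e) (flipped_param e)" if "e \<in> own_edges v" for e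
    using that own_edges_subset bernoulli_params[of "card e"]
    by (auto simp: edge_param_def flipped_param_def potential_edges_def own_edges_def intro!:
      bhattacharyya_pos)
  have "- (signal / (1 - s)\<^sup>2)
    \<le> (\<Sum>l\<in>L. real (n_out choose (l - 1)) * (- (hellinger_gap l / (1 - s)\<^sup>2)))"
    using divide_right_mono[OF sum_own_gap_le, of "(1 - s)\<^sup>2"]
    by (simp add: sum_negf sum_divide_distrib)
  also have "\<dots> \<le> (\<Sum>l\<in>L. real (n_out choose (l - 1)) * (ln (bhattacharyya (\<alpha> l) (\<beta> l))
    + ln (bhattacharyya (\<beta> l) (\<alpha> l))))"
  proof (intro sum_mono mult_left_mono)
    fix l assume l: "l \<in> L"
    show "- (hellinger_gap l / (1 - s)\<^sup>2)
      \<le> ln (bhattacharyya (\<alpha> l) (\<beta> l)) + ln (bhattacharyya (\<beta> l) (\<alpha> l))"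
      using ln_bhattacharyya_ge[OF beta_pos[OF l] beta_le_alpha[OF l] alpha_le[OF l] s_le]
      by (simp add: hellinger_gap_def bhattacharyya_commute[of "\<beta> l"])
  qed simp
  also have "\<dots> = (\<Sum>e\<in>own_edges v. ln (bhattacharyya (edge_param y e) (flipped_param e)))"
    using sum_own_edges[OF v, of "\<lambda>b l. ln (bhattacharyya (if b then \<alpha> l else \<beta> l)
      (if b then \<beta> l else \<alpha> l))"]
    by (simp add: edge_param_def flipped_param_def)
  finally have "exp (- (signal / (1 - s)\<^sup>2))
    \<le> exp (\<Sum>e\<in>own_edges v. ln (bhattacharyya (edge_param y e) (flipped_param e)))"
    by simp
  also have "\<dots> = (\<Prod>e\<in>own_edges v. exp (ln (bhattacharyya (edge_param y e) (flipped_param e))))"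
    using own_edges_subset finite_E by (intro exp_sum) (auto intro: finite_subset)
  also have "\<dots> = (\<Prod>e\<in>own_edges v. bhattacharyya (edge_param y e) (flipped_param e))"
    using bp by (intro prod.cong) auto
  finally show ?thesis .
qed

text \<open>Monochromatic and non-monochromatic own edges carry the same pair of parameters in
  opposite order. Hence they have the same tilted law and opposite log-likelihood ratios,
  so their means cancel and their variances agree.\<close>

lemma tilted_second_moment_own:
  assumes v: "v \<in> T"
  shows "subset_mean (\<lambda>e. tilt (edge_param y e) (flipped_param e)) (own_edges v)
    (\<lambda>X. (ln (subset_weight flipped_param (own_edges v) X
    / subset_weight (edge_param y) (own_edges v) X))\<^sup>2)
    \<le> 512 * signal"
proof -
  have fin: "finite (own_edges v)" using own_edges_subset finite_E finite_subset by blast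
  have card_own_edges: "card e \<in> L" if "e \<in> own_edges v" for e
    using that by (auto simp: own_edges_def potential_edges_def)
  have ep01: "0 < edge_param y e \<and> edge_param y e < 1" "0 < flipped_param e \<and> flipped_param e < 1"
    if "e \<in> own_edges v" for e
    using bernoulli_params[OF card_own_edges[OF that]]
      by (auto simp: edge_param_def flipped_param_def)
  have tilt_commute: "tilt a b = tilt b a" for a b
    by (simp add: tilt_def bhattacharyya_commute mult.commute)
  define p p' where "p b l = (if b then \<alpha> l else \<beta> l)" and "p' b l
    = (if b then \<beta> l else \<alpha> l)" for b l
  define ev where "ev b l = tilt (p b l) (p' b l) * ln (p' b l / p b l)
    + (1 - tilt (p b l) (p' b l)) * ln ((1 - p' b l) / (1 - p b l))" for b l
  define var where "var b l = tilt (p b l) (p' b l) * (1 - tilt (p b l) (p' b l))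
    * (ln (p' b l / p b l) - ln ((1 - p' b l) / (1 - p b l)))\<^sup>2" for b l
  have edge_param_p: "edge_param y e = p (monochromatic y e) (card e)" "flipped_param e
    = p' (monochromatic y e) (card e)" for e
    by (auto simp: edge_param_def flipped_param_def p_def p'_def)
  have swap_ln: "ln (p' False l / p False l) = - ln (p' True l / p True l)"
    "ln ((1 - p' False l) / (1 - p False l))
      = - ln ((1 - p' True l) / (1 - p True l))" if "l \<in> L" for l
    using bernoulli_params[OF that] by (auto simp: p_def p'_def ln_div)
  have tilt_TF: "tilt (p False l) (p' False l) = tilt (p True l) (p' True l)" for l
    by (simp add: p_def p'_def tilt_commute)
  have "(\<Sum>e\<in>own_edges v. tilt (edge_param y e) (flipped_param e)
    * ln (flipped_param e / edge_param y e)
      + (1 - tilt (edge_param y e) (flipped_param e))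
        * ln ((1 - flipped_param e) / (1 - edge_param y e)))
        = (\<Sum>e\<in>own_edges v. ev (monochromatic y e) (card e))"
    by (simp add: ev_def edge_param_p)
  also have "\<dots> = 0"
    unfolding sum_own_edges[OF v] by (intro sum.neutral ballI) (simp add: ev_def swap_ln tilt_TF)
  finally have "subset_mean (\<lambda>e. tilt (edge_param y e) (flipped_param e)) (own_edges v)
    (\<lambda>X. (ln (subset_weight flipped_param (own_edges v) X
    / subset_weight (edge_param y) (own_edges v) X))\<^sup>2)
      = (\<Sum>e\<in>own_edges v. var (monochromatic y e) (card e))"
    using ep01 by (subst second_moment_tilted[OF fin]) (auto simp: var_def edge_param_p)
  also have "\<dots> = (\<Sum>l\<in>L. real (n_out choose (l - 1)) * (var True l + var False l))"
    by (rule sum_own_edges[OF v])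
  also have "\<dots> \<le> (\<Sum>l\<in>L. real (n_out choose (l - 1)) * (512 * hellinger_gap l))"
  proof (intro sum_mono mult_left_mono)
    fix l assume l: "l \<in> L"
    have "var False l = var True l"
      unfolding var_def swap_ln[OF l] tilt_TF by (simp add: power2_eq_square algebra_simps)
    moreover have "var True l \<le> 256 * hellinger_gap l"
      using tilted_variance_le[OF beta_pos[OF l] beta_le_alpha[OF l] alpha_le[OF l] s_le]
      by (simp add: var_def p_def p'_def hellinger_gap_def)
    ultimately show "var True l + var False l \<le> 512 * hellinger_gap l" by simp
  qed simp
  also have "\<dots> = 512 * (\<Sum>l\<in>L. real (n_out choose (l - 1)) * hellinger_gap l)"
    by (simp add: sum_distrib_left mult_ac)
  also have "\<dots> \<le> 512 * signal" using sum_own_gap_le by simp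
  finally show ?thesis .
qed

definition flip_favoured :: "real \<Rightarrow> nat \<Rightarrow> nat set set \<Rightarrow> bool" where
  "flip_favoured x v X \<longleftrightarrow> exp (- 2 * x) * subset_weight (edge_param y) (own_edges v) X
    \<le> subset_weight flipped_param (own_edges v) X"

lemma flip_favoured_restrict: "own_edges v \<subseteq> F \<Longrightarrow> flip_favoured x v X = flip_favoured x v (X \<inter> F)"
proof -
  assume "own_edges v \<subseteq> F"
  then have "subset_weight p (own_edges v) X = subset_weight p (own_edges v) (X \<inter> F)" for p
    by (intro subset_weight_cong) auto
  then show ?thesis by (simp add: flip_favoured_def)
qed

lemma flip_favoured_prob:
  assumes v: "v \<in> T" and x: "0 < x" "256 * signal \<le> x\<^sup>2"
  shows "flip_prob x \<le> subset_mean (edge_param y) E (\<lambda>X. of_bool (flip_favoured x v X))"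
proof -
  have fin: "finite (own_edges v)" using own_edges_subset finite_E finite_subset by blast
  have card_own_edges: "card e \<in> L" if "e \<in> own_edges v" for e
    using that by (auto simp: own_edges_def potential_edges_def)
  have ep01: "0 < edge_param y e \<and> edge_param y e < 1" "0 < flipped_param e \<and> flipped_param e < 1"
    if "e \<in> own_edges v" for e
    using bernoulli_params[OF card_own_edges[OF that]]
      by (auto simp: edge_param_def flipped_param_def)
  let ?V = "subset_mean (\<lambda>e. tilt (edge_param y e) (flipped_param e)) (own_edges v)
    (\<lambda>X. (ln (subset_weight flipped_param (own_edges v) X
    / subset_weight (edge_param y) (own_edges v) X))\<^sup>2)"
  have "?V / (2 * x)\<^sup>2 \<le> (512 * signal) / (2 * x)\<^sup>2"
    by (intro divide_right_mono tilted_second_moment_own v) simp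
  also have "\<dots> \<le> 1 / 2" using x by (simp add: field_simps)
  finally have half: "1 / 2 \<le> 1 - ?V / (2 * x)\<^sup>2" by simp
  have "flip_prob x = exp (- (signal / (1 - s)\<^sup>2)) * exp (- x) * (1 / 2)"
    by (simp add: flip_prob_def exp_add[symmetric])
  also have "\<dots> \<le> (\<Prod>e\<in>own_edges v. bhattacharyya (edge_param y e) (flipped_param e)) * exp (- x)
    * (1 - ?V / (2 * x)\<^sup>2)"
    using order_trans[OF _ prod_bhattacharyya_own[OF v], of 0]
    by (intro mult_mono prod_bhattacharyya_own v half) auto
  also have "\<dots> \<le> subset_mean (edge_param y) (own_edges v) (\<lambda>X. of_bool (flip_favoured x v X))"
    unfolding flip_favoured_def by (rule tilting_lower_bound[OF fin ep01 x(1)])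
  also have "\<dots> = subset_mean (edge_param y) E (\<lambda>X. of_bool (flip_favoured x v X))"
    by (rule subset_mean_restrict[symmetric, OF finite_E own_edges_subset])
      (simp flip: flip_favoured_restrict)
  finally show ?thesis .
qed

text \<open>Three things can go wrong: too few flippable vertices in one of the two classes, or
  edges with two marked vertices that spoil more than half of the partners of every
  flippable vertex.\<close>

lemma not_swappable_prob:
  assumes \<sigma>: "\<sigma> \<in> {-1, 1}" and x: "0 < x" "256 * signal \<le> x\<^sup>2"
  shows "subset_mean (edge_param y) E (\<lambda>X. of_bool (\<not> swappable x (t * flip_prob x / 4) \<sigma> y X))
    \<le> 8 / (t * flip_prob x) + 64 * real t * pair_gap"
proof -
  define I J where "I = {v\<in>T. y v = \<sigma>}" and "J = {v\<in>T. y v = - \<sigma>}"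
  have m\<sigma>: "- \<sigma> \<in> {-1, 1}" "\<sigma> \<noteq> - \<sigma>" using \<sigma> by auto
  have IJ: "finite I" "finite J" "card I = t" "card J = t" "I \<subseteq> T" "J \<subseteq> T"
    using finite_T card_T \<sigma> m\<sigma> by (auto simp: I_def J_def)
  then have ne: "I \<noteq> {}" "J \<noteq> {}" using t_pos by auto
  have ep01: "0 \<le> edge_param y e \<and> edge_param y e \<le> 1" if "e \<in> E" for e
    using edge_param_bounds[OF that, of y] by auto
  define F where "F u w X \<longleftrightarrow> subset_weight (edge_param
    (swap_labels u w y)) other_edges X < subset_weight (edge_param y) other_edges X / 4" for u w X
  define few where "few K X \<longleftrightarrow> real (card {i\<in>K. flip_favoured x i X}) < t
    * flip_prob x / 2" for K :: "nat set" and X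
  define bad where "bad X \<longleftrightarrow> (\<exists>i\<in>I. flip_favoured x i X) \<and>
      (\<forall>i\<in>I. flip_favoured x i X \<longrightarrow> 2 * card {j\<in>J. flip_favoured x j X
        \<and> \<not> F i j X} < card {j\<in>J. flip_favoured x j X})" for X
  have pair: "swapped_pair N L \<alpha> \<beta> s y T t u w" if "u \<in> I" "w \<in> J" for u w
    using that m\<sigma> by unfold_locales (auto simp: I_def J_def)
  have few_prob: "subset_mean (edge_param y) E (\<lambda>X. of_bool (few K X)) \<le> 4 / (t * flip_prob x)"
    if K: "finite K" "K \<noteq> {}" "K \<subseteq> T" "card K = t" for K
    unfolding few_def K(4)[symmetric]
    by (rule many_events_occur[OF finite_E ep01 K(1,2), where A = own_edges])
      (use K(3) x own_edges_subset own_edges_disjoint flip_favoured_restrict flip_favoured_prob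
        flip_prob_pos in auto)
  have bad_prob: "subset_mean (edge_param y) E (\<lambda>X. of_bool (bad X))
    \<le> 2 * (32 * real t * pair_gap)"
    unfolding bad_def
  proof (rule random_pair_survives[OF finite_E ep01 IJ(1,2), where A = "E - other_edges" and B
    = other_edges])
    fix i X assume "i \<in> I"
    then have "own_edges i \<subseteq> E - other_edges"
      using IJ own_edges_subset by (auto simp: other_edges_def)
    then show "flip_favoured x i X = flip_favoured x i (X \<inter> (E - other_edges))"
      by (rule flip_favoured_restrict)
  next
    fix j X assume "j \<in> J"
    then have "own_edges j \<subseteq> E - other_edges"
      using IJ own_edges_subset by (auto simp: other_edges_def)
    then show "flip_favoured x j X = flip_favoured x j (X \<inter> (E - other_edges))"
      by (rule flip_favoured_restrict)
  next
    fix i j X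
    have "subset_weight p other_edges X = subset_weight p other_edges (X \<inter> other_edges)" for p
      by (rule subset_weight_cong) auto
    then show "F i j X = F i j (X \<inter> other_edges)" unfolding F_def by simp
  next
    fix i j assume "i \<in> I" "j \<in> J"
    then interpret swapped_pair N L \<alpha> \<beta> s y T t i j by (rule pair)
    show "subset_mean (edge_param y) E (\<lambda>X. of_bool (F i j X)) \<le> 32 * real t * pair_gap"
      unfolding F_def by (rule other_edges_ratio_rarely_small)
  next
    show "0 \<le> 32 * real t * pair_gap" using pair_gap_nonneg by simp
  qed (auto simp: other_edges_def)
  have swap: "swappable x (t * flip_prob x / 4) \<sigma> y X"
    if typical: "\<not> few I X" "\<not> few J X" "\<not> bad X" for X
  proof -
    have "0 < t * flip_prob x / 2" using t_pos flip_prob_pos by simp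
    then have "card {i\<in>I. flip_favoured x i X} \<noteq> 0" using typical(1) unfolding few_def by linarith
    then have "\<exists>i\<in>I. flip_favoured x i X"
      by (metis (mono_tags, lifting) card.empty empty_Collect_eq)
    then obtain i where i: "i \<in> I" "flip_favoured x i X"
      and most: "card {j\<in>J. flip_favoured x j X}
        \<le> 2 * card {j\<in>J. flip_favoured x j X \<and> \<not> F i j X}"
      using typical(3) unfolding bad_def by force
    have "{j\<in>J. flip_favoured x j X \<and> \<not> F i j X}
      \<subseteq> {w\<in>{..<N}. y w = - \<sigma> \<and> exp (- 4 * x) / 4 * subset_weight (edge_param y) E X
        \<le> subset_weight (edge_param (swap_labels i w y)) E X}"
    proof clarify
      fix j assume j: "j \<in> J" "flip_favoured x j X" "\<not> F i j X"
      interpret swapped_pair N L \<alpha> \<beta> s y T t i j by (rule pair[OF i(1) j(1)])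
      show "j \<in> {..<N} \<and> y j = - \<sigma> \<and> exp (- 4 * x) / 4 * subset_weight (edge_param y) E X
        \<le> subset_weight (edge_param (swap_labels i j y)) E X"
        using swap_weight_ge[of X x] i j uw_less by (auto simp: flip_favoured_def F_def J_def)
    qed
    then have "card {j\<in>J. flip_favoured x j X \<and> \<not> F i j X}
      \<le> card {w\<in>{..<N}. y w = - \<sigma> \<and> exp (- 4 * x) / 4 * subset_weight (edge_param y) E X
        \<le> subset_weight (edge_param (swap_labels i w y)) E X}"
      by (intro card_mono) auto
    moreover have "t * flip_prob x / 2 \<le> card {j\<in>J. flip_favoured x j X}"
      using typical(2) unfolding few_def by simp
    ultimately have "t * flip_prob x / 4
      \<le> card {w\<in>{..<N}. y w = - \<sigma> \<and> exp (- 4 * x) / 4 * subset_weight (edge_param y) E X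
        \<le> subset_weight (edge_param (swap_labels i w y)) E X}"
      using most by linarith
    moreover have "i < N" "y i = \<sigma>" using i T by (auto simp: I_def)
    ultimately show ?thesis unfolding swappable_def by blast
  qed
  have "subset_mean (edge_param y) E (\<lambda>X. of_bool (\<not> swappable x (t * flip_prob x / 4) \<sigma> y X))
      \<le> subset_mean (edge_param y) E (\<lambda>X. (of_bool (few I X) + of_bool (few J X))
        + of_bool (bad X))"
    by (rule subset_mean_mono[OF ep01]) (use swap in \<open>auto simp: of_bool_def\<close>)
  also have "\<dots> = (subset_mean (edge_param y) E (\<lambda>X. of_bool (few I X))
    + subset_mean (edge_param y) E (\<lambda>X. of_bool (few J X)))
      + subset_mean (edge_param y) E (\<lambda>X. of_bool (bad X))"
    by (simp only: subset_mean_add)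
  also have "\<dots> \<le> (4 / (t * flip_prob x) + 4 / (t * flip_prob x)) + 2 * (32 * real t * pair_gap)"
    using IJ ne by (intro add_mono few_prob bad_prob) auto
  finally show ?thesis by simp
qed

end


section \<open>Posterior mass near an estimate\<close>

text \<open>Here \<open>W\<close> is the posterior weight for a fixed hypergraph, \<open>z\<close> the estimate and \<open>\<sigma>\<close> the
  label of its larger class. The swaps of the vectors in \<open>Y\<close> are compared with the total
  mass: each vector has at least \<open>M - 1\<close> swaps that carry at least the part \<open>c\<close> of its
  weight, and every balanced vector is such a swap at most twice.\<close>

lemma near_balanced_mass:
  fixes W :: "(nat \<Rightarrow> int) \<Rightarrow> real" and M c :: real
  assumes W: "\<And>y. 0 \<le> W y" and c: "0 \<le> c" and M: "1 \<le> M"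
    and \<sigma>: "\<sigma> \<in> {-1, 1}" and z: "\<And>v. v < N \<Longrightarrow> z v = 1 \<or> z v = (-1 :: int)"
    and majority: "0 \<le> \<sigma> * (\<Sum>v<N. z v)"
  defines "Y \<equiv> {y \<in> balanced_labels N. card {v\<in>{..<N}. y v \<noteq> z v} \<le> 1 \<and> (\<exists>u<N. y u = \<sigma> \<and>
     M \<le> card {w\<in>{..<N}. y w = - \<sigma> \<and> c * W y \<le> W (swap_labels u w y)})}"
  shows "(M - 1) * c * (\<Sum>y\<in>Y. W y) \<le> 2 * (\<Sum>y\<in>balanced_labels N. W y)"
proof -
  define uf where "uf y = (SOME u. u < N \<and> y u = \<sigma> \<and>
     M \<le> card {w\<in>{..<N}. y w = - \<sigma> \<and> c * W y \<le> W (swap_labels u w y)})" for y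
  define B where "B y = {w\<in>{..<N}. y w = - \<sigma> \<and> c * W y \<le> W (swap_labels (uf y) w y)}" for y
  define D where "D y = {v\<in>{..<N}. y v \<noteq> z v}" for y
  define P where "P = Sigma Y (\<lambda>y. B y - D y)"
  define G where "G y' = {v\<in>{..<N}. z v = \<sigma> \<and> y' v = - \<sigma>}" for y'
  \<comment> \<open>The set \<open>D y\<close> of errors of the estimate has at most one element. Partners in
    \<open>D y\<close> are discarded, since such a swap would merely move the error and be hit by
    many vectors. The map \<open>g\<close> remembers \<open>uf y\<close>, which makes it injective, and
    \<open>G y'\<close>, of size at most two, lists the candidates for \<open>uf y\<close> that can be read
    off from a swap \<open>y'\<close>.\<close>
  define g where "g = (\<lambda>(y, w). (swap_labels (uf y) w y, uf y))"
  have \<sigma>_neq: "\<sigma> \<noteq> - \<sigma>" using \<sigma> by auto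
  have YB: "Y \<subseteq> balanced_labels N" by (auto simp: Y_def)
  then have fin_Y: "finite Y" using finite_balanced_labels finite_subset by blast
  have fin_P: "finite P" unfolding P_def using fin_Y by (auto simp: B_def)
  have uf: "uf y < N \<and> y (uf y) = \<sigma> \<and> M \<le> card (B y)" if "y \<in> Y" for y
  proof -
    have "\<exists>u<N. y u = \<sigma> \<and> M \<le> card {w\<in>{..<N}. y w = - \<sigma> \<and> c * W y \<le> W (swap_labels u w y)}"
      using that by (auto simp: Y_def)
    from someI_ex[OF this] show ?thesis unfolding uf_def[of y, symmetric] B_def .
  qed
  have card_D: "card (D y) \<le> 1" if "y \<in> Y" for y using that by (simp add: Y_def D_def)
  \<comment> \<open>An error must lie in the larger class of the estimate, since \<open>y\<close> is balanced.\<close>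
  have D_sign: "z v = \<sigma> \<and> y v = - \<sigma>" if yY: "y \<in> Y" and v: "v \<in> D y" for y v
  proof -
    have yb: "y \<in> balanced_labels N" using yY YB by auto
    have vN: "v < N" using v by (simp add: D_def)
    have only: "y a = z a" if "a < N" "a \<noteq> v" for a
      using card_D[OF yY] v that by (auto simp: card_le_Suc0_iff_eq D_def)
    have "(\<Sum>a<N. z a) = z v + (\<Sum>a\<in>{..<N} - {v}. z a)" using vN by (simp add: sum.remove)
    also have "(\<Sum>a\<in>{..<N} - {v}. z a) = (\<Sum>a\<in>{..<N} - {v}. y a)"
      using only by (intro sum.cong) auto
    also have "z v + \<dots> = z v - y v + (\<Sum>a<N. y a)" using vN by (simp add: sum.remove)
    also have "(\<Sum>a<N. y a) = 0" using yb by (simp add: balanced_labels_def)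
    finally have "0 \<le> \<sigma> * (z v - y v)" using majority by simp
    then show ?thesis
      using z[OF vN] balanced_labelsD(1)[OF yb vN] \<sigma> v by (auto simp: D_def)
  qed
  have P_facts: "z (uf y) = \<sigma>" "y (uf y) = \<sigma>" "uf y < N" "z w = - \<sigma>" "y w
    = - \<sigma>" "w < N" "uf y \<noteq> w" "y \<in> Y"
    if "(y, w) \<in> P" for y w
  proof -
    have yY: "y \<in> Y" and w: "w \<in> B y" "w \<notin> D y" using that by (auto simp: P_def)
    show 1: "y (uf y) = \<sigma>" and 2: "uf y < N" using uf[OF yY] by blast+
    have "uf y \<notin> D y" using D_sign[OF yY, of "uf y"] \<sigma>_neq 1 by metis
    then show "z (uf y) = \<sigma>" using 1 2 unfolding D_def by simp
    show 3: "y w = - \<sigma>" and 4: "w < N" using w(1) unfolding B_def by blast+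
    show "z w = - \<sigma>" using w(2) 3 4 unfolding D_def by simp
    show "uf y \<noteq> w" using 1 3 \<sigma>_neq by metis
    show "y \<in> Y" by fact
  qed
  have off_D: "y v = z v" if "y \<in> Y" "v < N" "\<not> (z v = \<sigma> \<and> y v = - \<sigma>)" for y v
    using D_sign[OF that(1)] that by (auto simp: D_def)
  have swap_at: "swap_labels (uf y) w y (uf y) = - \<sigma>" "swap_labels (uf y) w y w = \<sigma>"
    "v \<noteq> uf y \<Longrightarrow> v \<noteq> w \<Longrightarrow> swap_labels (uf y) w y v = y v" if "(y, w) \<in> P" for y w v
    unfolding swap_labels_def using P_facts(2,5,7)[OF that] by simp_all
  have G_eq: "G (swap_labels (uf y) w y) = insert (uf y) (D y)" if P: "(y, w) \<in> P" for y w
  proof (intro equalityI subsetI)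
    fix v assume v: "v \<in> G (swap_labels (uf y) w y)"
    show "v \<in> insert (uf y) (D y)"
    proof (cases "v = uf y")
      case False
      have "v \<noteq> w" using v P_facts(4)[OF P] \<sigma>_neq unfolding G_def by force
      then have "y v = - \<sigma>" using v swap_at(3)[OF P False] unfolding G_def by force
      then show ?thesis using v \<sigma>_neq unfolding G_def D_def by force
    qed simp
  next
    fix v assume "v \<in> insert (uf y) (D y)"
    then consider "v = uf y" | "v \<in> D y" by blast
    then show "v \<in> G (swap_labels (uf y) w y)"
    proof cases
      case 1
      then show ?thesis unfolding G_def using swap_at(1)[OF P] P_facts(1,3)[OF P] by simp
    next
      case 2
      note sign = D_sign[OF P_facts(8)[OF P] 2]
      have "v \<noteq> uf y" using sign P_facts(2)[OF P] \<sigma>_neq by metis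
      moreover have "v \<noteq> w" using sign P_facts(4)[OF P] \<sigma>_neq by metis
      ultimately have "swap_labels (uf y) w y v = y v" by (rule swap_at(3)[OF P])
      moreover have "v < N" using 2 unfolding D_def by simp
      ultimately show ?thesis unfolding G_def using sign by simp
    qed
  qed
  have w_unique: "v = w" if P: "(y, w) \<in> P" and v: "v < N" "z v = - \<sigma>" "swap_labels (uf y) w y v
    = \<sigma>" for y w v
  proof (rule ccontr)
    assume "v \<noteq> w"
    moreover have "v \<noteq> uf y" using v(2) P_facts(1)[OF P] \<sigma>_neq by metis
    ultimately have "y v = \<sigma>" using swap_at(3)[OF P] v(3) by metis
    then have "y v \<noteq> z v" "z v \<noteq> \<sigma>" using v(2) \<sigma>_neq by metis+
    then show False using off_D[OF P_facts(8)[OF P] v(1)] by blast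
  qed
  have inj: "inj_on g P"
  proof (rule inj_onI, clarify)
    fix y1 w1 y2 w2
    assume P: "(y1, w1) \<in> P" "(y2, w2) \<in> P" and eq: "g (y1, w1) = g (y2, w2)"
    have ueq: "uf y1 = uf y2" and seq: "swap_labels (uf y1) w1 y1 = swap_labels (uf y2) w2 y2"
      using eq by (auto simp: g_def)
    have weq: "w1 = w2"
      using w_unique[OF P(2) P_facts(6,4)[OF P(1)]] swap_at(2)[OF P(1)] seq by simp
    have "y = swap_labels (uf y) w (swap_labels (uf y) w y)" for y w
      by (auto simp: swap_labels_def fun_eq_iff)
    then show "y1 = y2 \<and> w1 = w2" using ueq seq weq by metis
  qed
  have image: "g ` P \<subseteq> Sigma {y'\<in>balanced_labels N. card (G y') \<le> 2} G"
  proof (rule image_subsetI)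
    fix p assume "p \<in> P"
    then obtain y w where p: "p = (y, w)" and P: "(y, w) \<in> P" by (cases p) auto
    note f = P_facts[OF P]
    have "swap_labels (uf y) w y \<in> balanced_labels N"
      using f YB by (intro swap_labels_balanced) auto
    moreover have "card (G (swap_labels (uf y) w y)) \<le> 2"
      unfolding G_eq[OF P] using card_D[OF f(8)] card_insert_le_m1[of 2 "D y" "uf y"] by simp
    moreover have "uf y \<in> G (swap_labels (uf y) w y)" unfolding G_eq[OF P] by simp
    ultimately show "g p \<in> Sigma {y'\<in>balanced_labels N. card (G y') \<le> 2} G"
      by (simp add: p g_def)
  qed
  have "(M - 1) * c * (\<Sum>y\<in>Y. W y) \<le> (\<Sum>y\<in>Y. \<Sum>w\<in>B y - D y. c * W y)"
    unfolding sum_distrib_left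
  proof (rule sum_mono)
    fix y assume y: "y \<in> Y"
    have "card (B y) - card (D y) \<le> card (B y - D y)"
      by (rule diff_card_le_card_Diff) (simp add: D_def)
    then have "card (B y) \<le> card (B y - D y) + 1" using card_D[OF y] by simp
    then have "M - 1 \<le> card (B y - D y)" using uf[OF y] by linarith
    then show "(M - 1) * c * W y \<le> (\<Sum>w\<in>B y - D y. c * W y)"
      using c W[of y] by (simp add: mult.assoc mult_right_mono)
  qed
  also have "\<dots> = (\<Sum>(y, w)\<in>P. c * W y)"
    unfolding P_def using fin_Y by (intro sum.Sigma) (auto simp: B_def)
  also have "\<dots> \<le> (\<Sum>p\<in>P. W (fst (g p)))"
    by (rule sum_mono) (auto simp: P_def g_def B_def)
  also have "\<dots> = (\<Sum>(y', u)\<in>g ` P. W y')"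
    using sum.reindex[OF inj, of "\<lambda>(y', u). W y'"] by (simp add: case_prod_unfold comp_def)
  also have "\<dots> \<le> (\<Sum>(y', u)\<in>Sigma {y'\<in>balanced_labels N. card (G y') \<le> 2} G. W y')"
    using finite_balanced_labels W
      by (intro sum_mono2 image) (auto simp: G_def intro!: finite_SigmaI)
  also have "\<dots> = (\<Sum>y'\<in>{y'\<in>balanced_labels N. card (G y') \<le> 2}. \<Sum>u\<in>G y'. W y')"
    using finite_balanced_labels by (intro sum.Sigma[symmetric]) (auto simp: G_def)
  also have "\<dots> \<le> (\<Sum>y'\<in>{y'\<in>balanced_labels N. card (G y') \<le> 2}. 2 * W y')"
    using W by (intro sum_mono) (auto intro!: mult_right_mono)
  also have "\<dots> \<le> (\<Sum>y'\<in>balanced_labels N. 2 * W y')"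
    using finite_balanced_labels W by (intro sum_mono2) auto
  finally show ?thesis by (simp add: sum_distrib_left)
qed


section \<open>From weights to the stochastic block model\<close>

lemma balanced_labels_nonempty:
  assumes "even N"
  shows "balanced_labels N \<noteq> {}"
proof -
  obtain m where m: "N = m + m" using assms by (metis even_two_times_div_two mult_2)
  define z where "z = (\<lambda>v\<in>{..<N}. if v < m then 1 else -1 :: int)"
  have halves: "{..<N} = {..<m} \<union> {m..<m + m}" using m by auto
  have "(\<Sum>v<N. z v) = (\<Sum>v\<in>{..<m}. z v) + (\<Sum>v\<in>{m..<m + m}. z v)"
    unfolding halves by (rule sum.union_disjoint) auto
  also have "\<dots> = (\<Sum>v\<in>{..<m}. 1) + (\<Sum>v\<in>{m..<m + m}. -1)"
    using m by (intro arg_cong2[where f = "(+)"] sum.cong) (auto simp: z_def)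
  also have "\<dots> = 0" by simp
  finally have "z \<in> balanced_labels N"
    by (auto simp: balanced_labels_def z_def)
  then show ?thesis by auto
qed

lemma exists_marked_set:
  assumes y: "y \<in> balanced_labels N" and t: "2 * t \<le> N"
  obtains T where "T \<subseteq> {..<N}" "\<forall>\<sigma>\<in>{-1, 1}. card {v\<in>T. y v = \<sigma>} = t"
proof -
  have "\<exists>S. S \<subseteq> {v\<in>{..<N}. y v = \<sigma>} \<and> card S = t" if "\<sigma> \<in> {-1, 1}" for \<sigma>
    using balanced_labelsD(2)[OF y that] t obtain_subset_with_card_n[of t "{v\<in>{..<N}. y v = \<sigma>}"]
    by (metis (no_types, lifting) mult_le_cancel1 zero_less_numeral)
  then obtain S1 S2 where S: "S1 \<subseteq> {v\<in>{..<N}. y v = 1}" "card S1 = t"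
    "S2 \<subseteq> {v\<in>{..<N}. y v = -1}" "card S2 = t" by (metis insertCI)
  have "{v\<in>S1 \<union> S2. y v = 1} = S1" "{v\<in>S1 \<union> S2. y v = -1} = S2" using S by auto
  then show ?thesis using S by (intro that[of "S1 \<union> S2"]) auto
qed

lemma mismatch_small_imp_near:
  assumes "0 < N" "real N * mismatch_ratio N y z < 2"
  shows "card {v\<in>{..<N}. y v \<noteq> z v} \<le> 1 \<or> card {v\<in>{..<N}. y v \<noteq> - z v} \<le> 1"
proof -
  let ?c = "\<lambda>s. card {v\<in>{..<N}. s * y v \<noteq> z v}"
  have "(MIN s\<in>{-1, 1}. ?c s) < 2"
    using assms by (simp add: mismatch_ratio_def del: Min_insert image_insert)
  moreover have "(MIN s\<in>{-1, 1}. ?c s) \<in> ?c ` {-1, 1}" by (intro Min_in) auto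
  ultimately have "?c 1 \<le> 1 \<or> ?c (-1) \<le> 1" by auto
  moreover have "{v\<in>{..<N}. -1 * y v \<noteq> z v} = {v\<in>{..<N}. y v \<noteq> - z v}" by auto
  ultimately show ?thesis by simp
qed

context block_model
begin

lemma pmf_hypergraph:
  assumes X: "X \<subseteq> E"
  shows "pmf (hypergraph_pmf L N \<alpha> \<beta> y) X = subset_weight (edge_param y) E X"
proof -
  have inj: "inj (Collect :: (nat set \<Rightarrow> bool) \<Rightarrow> nat set set)" by (auto simp: inj_def)
  have "pmf (hypergraph_pmf L N \<alpha> \<beta> y) (Collect (\<lambda>e. e \<in> X))
      = (\<Prod>e\<in>E. pmf (bernoulli_pmf (if monochromatic y e then \<alpha> (card e) else \<beta> (card e)))
        (e \<in> X))"
    unfolding hypergraph_pmf_def using X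
    by (subst pmf_map_inj'[OF inj], subst pmf_Pi') (auto simp: finite_E)
  also have "\<dots> = subset_weight (edge_param y) E X"
    unfolding subset_weight_def
  proof (intro prod.cong refl)
    fix e assume "e \<in> E"
    from edge_param_bounds[OF this, of y]
    show "pmf (bernoulli_pmf (if monochromatic y e then \<alpha> (card e) else \<beta> (card e))) (e \<in> X)
      = (if e \<in> X then edge_param y e else 1 - edge_param y e)"
      unfolding edge_param_def by (cases "e \<in> X") auto
  qed
  finally show ?thesis by simp
qed

lemma set_hypergraph: "set_pmf (hypergraph_pmf L N \<alpha> \<beta> y) \<subseteq> Pow E"
  unfolding hypergraph_pmf_def using set_Pi_pmf_subset[OF finite_E] by fastforce

lemma prob_hypergraph:
  "measure_pmf.prob (hypergraph_pmf L N \<alpha> \<beta> y) {X. P X}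
    = subset_mean (edge_param y) E (\<lambda>X. of_bool (P X))"
proof -
  have "measure_pmf.prob (hypergraph_pmf L N \<alpha> \<beta> y) {X. P X}
      = measure_pmf.prob (hypergraph_pmf L N \<alpha> \<beta> y) {X \<in> Pow E. P X}"
  proof (rule measure_prob_cong_0)
    fix X assume "X \<in> {X. P X} - {X \<in> Pow E. P X}"
    then have "X \<notin> set_pmf (hypergraph_pmf L N \<alpha> \<beta> y)" using set_hypergraph[of y] by blast
    then show "pmf (hypergraph_pmf L N \<alpha> \<beta> y) X = 0" by (simp add: set_pmf_iff)
  qed auto
  also have "\<dots> = (\<Sum>X\<in>{X \<in> Pow E. P X}. pmf (hypergraph_pmf L N \<alpha> \<beta> y) X)"
    using finite_E by (intro measure_measure_pmf_finite) auto
  also have "\<dots> = (\<Sum>X\<in>Pow E. subset_weight (edge_param y) E X * of_bool (P X))"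
    using finite_E by (intro sum.mono_neutral_cong_left) (auto simp: pmf_hypergraph)
  finally show ?thesis by (simp add: subset_mean_def)
qed

text \<open>Summed over all label vectors, the probability of at most one error splits into atypical
  hypergraphs, which are rare for each vector separately, and typical ones, for which the
  order of summation is exchanged and the mass near the estimate is bounded for each
  hypergraph. The estimate and its negative both count, because labels are identified up
  to a global sign.\<close>

lemma near_estimator_mean_le:
  assumes N: "even N" "0 < N"
    and est: "\<And>X. X \<subseteq> E \<Longrightarrow> est X \<in> {..<N} \<rightarrow> {-1, 1 :: int}"
    and t: "1 \<le> t" "2 * t \<le> N" and x: "0 < x" "256 * signal \<le> x\<^sup>2"
    and M: "1 < real t * flip_prob x / 4"
  shows "(\<Sum>y\<in>balanced_labels N. subset_mean (edge_param y) E (\<lambda>X. of_bool (real N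
    * mismatch_ratio N y (est X) < 2)))
    \<le> card (balanced_labels N) * (16 / (t * flip_prob x) + 128 * real t * pair_gap
        + 16 * exp (4 * x) / (t * flip_prob x / 4 - 1))"
proof -
  define M where "M = real t * flip_prob x / 4"
  define c where "c = exp (- 4 * x) / 4"
  define near where "near y z \<longleftrightarrow> card {v\<in>{..<N}. y v \<noteq> z v} \<le> 1" for y z :: "nat \<Rightarrow> int"
  let ?B = "balanced_labels N"
  have ep01: "0 \<le> edge_param y e \<and> edge_param y e \<le> 1" if "e \<in> E" for y e
    using edge_param_bounds[OF that, of y] by auto
  have c: "0 < c" by (simp add: c_def)
  have M1: "1 < M" using M by (simp add: M_def)
  have subset_weight_nn: "0 \<le> subset_weight (edge_param y) E X" for y X
    using ep01 by (intro subset_weight_nonneg) auto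
  have not_sw: "subset_mean (edge_param y) E (\<lambda>X. of_bool (\<not> swappable x M \<sigma> y X))
    \<le> 8 / (t * flip_prob x) + 64 * real t * pair_gap"
    if y: "y \<in> ?B" and \<sigma>: "\<sigma> \<in> {-1, 1}" for y \<sigma>
  proof -
    obtain T where T: "T \<subseteq> {..<N}" "\<forall>\<sigma>\<in>{-1, 1}. card {v\<in>T. y v = \<sigma>} = t"
      using exists_marked_set[OF y t(2)] .
    interpret marked_labels N L \<alpha> \<beta> s y T t
      using y T t by unfold_locales auto
    show ?thesis unfolding M_def by (rule not_swappable_prob[OF \<sigma> x])
  qed
  have near_mass: "(M - 1) * c * (\<Sum>y\<in>?B. subset_weight (edge_param y) E X * of_bool (near y z
    \<and> swappable x M (-1) y X \<and> swappable x M 1 y X))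
      \<le> 2 * (\<Sum>y\<in>?B. subset_weight (edge_param y) E X)" if z: "\<And>v. v < N
        \<Longrightarrow> z v = 1 \<or> z v = -1" for X z
  proof -
    obtain \<sigma> :: int where \<sigma>: "\<sigma> \<in> {-1, 1}" "0 \<le> \<sigma> * (\<Sum>v<N. z v)"
      by (cases "0 \<le> (\<Sum>v<N. z v)") (auto intro: that[of 1] that[of "-1"])
    have "(\<Sum>y\<in>?B. subset_weight (edge_param y) E X * of_bool (near y z \<and> swappable x M (-1) y X
      \<and> swappable x M 1 y X))
        \<le> (\<Sum>y\<in>?B. subset_weight (edge_param y) E X * of_bool (near y z \<and> swappable x M \<sigma> y X))"
      using \<sigma>(1) subset_weight_nn by (intro sum_mono mult_left_mono) auto
    also have "\<dots> = (\<Sum>y\<in>{y\<in>?B. near y z \<and> swappable x M \<sigma> y X}. subset_weight (edge_param y) E X)"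
      using finite_balanced_labels by (intro sum.mono_neutral_cong_right) auto
    finally have "(M - 1) * c * (\<Sum>y\<in>?B. subset_weight (edge_param y) E X * of_bool (near y z
      \<and> swappable x M (-1) y X \<and> swappable x M 1 y X))
      \<le> (M - 1) * c * (\<Sum>y\<in>{y\<in>?B. near y z
        \<and> swappable x M \<sigma> y X}. subset_weight (edge_param y) E X)"
      using M1 c by (intro mult_left_mono) auto
    also have "\<dots> \<le> 2 * (\<Sum>y\<in>?B. subset_weight (edge_param y) E X)"
      using near_balanced_mass[of "\<lambda>y. subset_weight
        (edge_param y) E X" c M \<sigma> N z] subset_weight_nn c M1 \<sigma> z
      unfolding near_def swappable_def c_def by auto
    finally show ?thesis .
  qed
  have "(\<Sum>y\<in>?B. subset_mean (edge_param y) E (\<lambda>X. of_bool (real N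
    * mismatch_ratio N y (est X) < 2)))
      \<le> (\<Sum>y\<in>?B. subset_mean (edge_param y) E (\<lambda>X. (of_bool (\<not> swappable x M (-1) y X)
        + of_bool (\<not> swappable x M 1 y X))
          + (of_bool (near y (est X) \<and> swappable x M (-1) y X \<and> swappable x M 1 y X)
           + of_bool (near y (\<lambda>v. - est X v) \<and> swappable x M (-1) y X \<and> swappable x M 1 y X))))"
  proof (intro sum_mono subset_mean_mono ep01)
    fix y X
    show "of_bool (real N * mismatch_ratio N y (est X) < 2)
      \<le> ((of_bool (\<not> swappable x M (-1) y X) + of_bool (\<not> swappable x M 1 y X))
          + (of_bool (near y (est X) \<and> swappable x M (-1) y X \<and> swappable x M 1 y X)
           + of_bool (near y (\<lambda>v. - est X v) \<and> swappable x M (-1) y X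
             \<and> swappable x M 1 y X)) :: real)"
      using mismatch_small_imp_near[OF N(2), of y "est X"] unfolding near_def
        by (auto simp: of_bool_def)
  qed
  also have "\<dots> = (\<Sum>y\<in>?B. subset_mean (edge_param y) E (\<lambda>X. of_bool (\<not> swappable x M (-1) y X))
        + subset_mean (edge_param y) E (\<lambda>X. of_bool (\<not> swappable x M 1 y X)))
      + (\<Sum>X\<in>Pow E. (\<Sum>y\<in>?B. subset_weight (edge_param y) E X * of_bool (near y (est X)
        \<and> swappable x M (-1) y X \<and> swappable x M 1 y X))
        + (\<Sum>y\<in>?B. subset_weight (edge_param y) E X * of_bool (near y (\<lambda>v. - est X v)
          \<and> swappable x M (-1) y X \<and> swappable x M 1 y X)))"
    unfolding subset_mean_add sum.distrib subset_mean_def by (simp only: sum.swap[of _ "Pow E"])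
  also have "\<dots> \<le> (\<Sum>y\<in>?B. (8 / (t * flip_prob x) + 64 * real t * pair_gap) + (8 / (t * flip_prob x)
    + 64 * real t * pair_gap))
      + (\<Sum>X\<in>Pow E. 2 * (\<Sum>y\<in>?B. subset_weight (edge_param y) E X) / ((M - 1) * c)
        + 2 * (\<Sum>y\<in>?B. subset_weight (edge_param y) E X) / ((M - 1) * c))"
  proof (intro add_mono sum_mono not_sw)
    have pos: "0 < (M - 1) * c" using M1 c by simp
    fix X assume "X \<in> Pow E"
    then have z: "est X v = 1 \<or> est X v = -1" if "v < N" for v
      using est[of X] that by (auto simp: Pi_iff)
    have z': "- est X v = 1 \<or> - est X v = -1" if "v < N" for v using z[OF that] by auto
    show "(\<Sum>y\<in>?B. subset_weight (edge_param y) E X * of_bool (near y (est X)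
      \<and> swappable x M (-1) y X \<and> swappable x M 1 y X))
      \<le> 2 * (\<Sum>y\<in>?B. subset_weight (edge_param y) E X) / ((M - 1) * c)"
      using near_mass[of "est X" X] z pos by (simp add: pos_le_divide_eq mult.commute)
    show "(\<Sum>y\<in>?B. subset_weight (edge_param y) E X * of_bool (near y (\<lambda>v. - est X v)
      \<and> swappable x M (-1) y X \<and> swappable x M 1 y X))
      \<le> 2 * (\<Sum>y\<in>?B. subset_weight (edge_param y) E X) / ((M - 1) * c)"
      using near_mass[of "\<lambda>v. - est X v" X] z' pos by (simp add: pos_le_divide_eq mult.commute)
  qed auto
  also have "(\<Sum>X\<in>Pow E. 2 * (\<Sum>y\<in>?B. subset_weight (edge_param y) E X) / ((M - 1) * c)
    + 2 * (\<Sum>y\<in>?B. subset_weight (edge_param y) E X) / ((M - 1) * c))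
      = 4 / ((M - 1) * c) * (\<Sum>X\<in>Pow E. \<Sum>y\<in>?B. subset_weight (edge_param y) E X)"
    by (subst sum_distrib_left[of "4 / ((M - 1) * c)" _ "Pow E"]) (simp add: mult.commute)
  also have "(\<Sum>X\<in>Pow E. \<Sum>y\<in>?B. subset_weight (edge_param y) E X)
    = (\<Sum>y\<in>?B. subset_mean (edge_param y) E (\<lambda>_. 1))"
    unfolding subset_mean_def by (subst sum.swap) simp
  also have "\<dots> = card ?B" using finite_E by (simp add: subset_mean_const)
  also have "4 / ((M - 1) * c) = 16 * exp (4 * x) / (M - 1)"
    by (simp add: c_def exp_minus field_simps)
  finally show ?thesis unfolding M_def by (simp add: algebra_simps)
qed

end

lemma hsbm_failure_prob_ge:
  assumes "block_model L (\<lambda>l. edge_prob N q l (a l)) (\<lambda>l. edge_prob N q l (b l)) s"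
    and N: "even N" "0 < N"
    and est: "\<And>X. X \<subseteq> potential_edges L N \<Longrightarrow> est X \<in> {..<N} \<rightarrow> {-1, 1 :: int}"
  defines "sig \<equiv> block_model.signal N L (\<lambda>l. edge_prob N q l (a l)) (\<lambda>l. edge_prob N q l (b l))"
    and "gap \<equiv> block_model.pair_gap N L (\<lambda>l. edge_prob N q l (a l)) (\<lambda>l. edge_prob N q l (b l))"
    and "fp \<equiv> block_model.flip_prob N L (\<lambda>l. edge_prob N q l (a l)) (\<lambda>l. edge_prob N q l (b l)) s"
  assumes t: "1 \<le> t" "2 * t \<le> N" and x: "0 < x" "256 * sig \<le> x\<^sup>2"
    and M: "1 < real t * fp x / 4"
  shows "1 - (16 / (t * fp x) + 128 * real t * gap + 16 * exp (4 * x) / (t * fp x / 4 - 1))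
    \<le> measure_pmf.prob (hsbm L N a b q) {(y, H). real N * mismatch_ratio N y (est H) \<ge> 2}"
proof -
  interpret block_model N L "\<lambda>l. edge_prob N q l (a l)" "\<lambda>l. edge_prob N q l (b l)" s by fact
  let ?B = "balanced_labels N"
  let ?F = "{(y, H). real N * mismatch_ratio N y (est H) < 2}"
  let ?H = "\<lambda>y. hypergraph_pmf L N (\<lambda>l. edge_prob N q l (a l)) (\<lambda>l. edge_prob N q l (b l)) y"
  have card_pos: "0 < card ?B"
    using balanced_labels_nonempty[OF N(1)] finite_balanced_labels by (simp add: card_gt_0_iff)
  have "measure_pmf.prob (hsbm L N a b q) ?F
    = measure_pmf.expectation (hsbm L N a b q) (indicator ?F)"
    by simp
  also have "\<dots> = (\<Sum>y\<in>?B. measure_pmf.expectation (map_pmf (Pair y) (?H y)) (indicator ?F) /\<^sub>R real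
    (card ?B))"
    unfolding hsbm_def using finite_balanced_labels balanced_labels_nonempty[OF N(1)]
    by (subst pmf_expectation_bind_pmf_of_set)
      (auto intro!: finite_subset[OF set_hypergraph] finite_E)
  also have "\<dots> = (\<Sum>y\<in>?B. subset_mean (edge_param y) E (\<lambda>X. of_bool (real N
    * mismatch_ratio N y (est X) < 2)) / real (card ?B))"
  proof (intro sum.cong refl)
    fix y
    have "measure_pmf.expectation (map_pmf (Pair y) (?H y)) (indicator ?F)
      = measure_pmf.prob (?H y) {X. real N * mismatch_ratio N y (est X) < 2}"
      by (simp add: vimage_def del: integral_map_pmf)
    then show "measure_pmf.expectation (map_pmf (Pair y) (?H y)) (indicator ?F) /\<^sub>R real (card ?B)
      = subset_mean (edge_param y) E (\<lambda>X. of_bool (real N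
        * mismatch_ratio N y (est X) < 2)) / real (card ?B)"
      by (simp add: prob_hypergraph divide_inverse_commute)
  qed
  also have "\<dots> \<le> card ?B * (16 / (t * fp x) + 128 * real t * gap
    + 16 * exp (4 * x) / (t * fp x / 4 - 1)) / card ?B"
    unfolding sum_divide_distrib[symmetric] fp_def gap_def
    by (intro divide_right_mono near_estimator_mean_le N est t x(1) x(2)[unfolded sig_def]
      M[unfolded fp_def]) auto
  also have "\<dots> = 16 / (t * fp x) + 128 * real t * gap + 16 * exp (4 * x) / (t * fp x / 4 - 1)"
    using card_pos by simp
  finally have "measure_pmf.prob (hsbm L N a b q) ?F
    \<le> 16 / (t * fp x) + 128 * real t * gap + 16 * exp (4 * x) / (t * fp x / 4 - 1)" .
  moreover have "{(y, H). real N * mismatch_ratio N y (est H) \<ge> 2} = UNIV - ?F" by auto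
  ultimately show ?thesis
    using measure_pmf.prob_compl[of ?F "hsbm L N a b q"] by simp
qed


section \<open>Asymptotics\<close>

lemma signal_eq_D_GH:
  assumes model: "block_model L (\<lambda>l. edge_prob N q l (a l)) (\<lambda>l. edge_prob N q l (b l)) s"
    and L: "\<And>l. l \<in> L \<Longrightarrow> l \<le> N" and q: "0 \<le> q"
  shows "block_model.signal N L (\<lambda>l. edge_prob N q l (a l)) (\<lambda>l. edge_prob N q l (b l))
    = D_GH L a b * q"
proof -
  interpret block_model N L "\<lambda>l. edge_prob N q l (a l)" "\<lambda>l. edge_prob N q l (b l)" s
    by (rule model)
  show ?thesis
    unfolding signal_def D_GH_def sum_distrib_right
  proof (rule sum.cong)
    fix l assume l: "l \<in> L"
    define C where "C = real ((N - 1) choose (l - 1))"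
    have C: "0 < C" using L[OF l] by (simp add: C_def)
    have "sqrt (edge_prob N q l (a l)) - sqrt (edge_prob N q l (b l))
      = (sqrt (a l) - sqrt (b l)) * sqrt (q / C)"
      unfolding edge_prob_def C_def[symmetric]
      by (simp add: real_sqrt_mult real_sqrt_divide left_diff_distrib diff_divide_distrib)
    then have "hellinger_gap l = (sqrt (a l) - sqrt (b l))\<^sup>2 * (q / C)"
      using q C by (simp add: hellinger_gap_def power_mult_distrib)
    then show "real ((N - 1) choose (l - 1)) * hellinger_gap l / 2 ^ (l - 1)
        = 1 / 2 ^ (l - 1) * (sqrt (a l) - sqrt (b l))\<^sup>2 * q"
      using C unfolding C_def[symmetric] by simp
  qed simp
qed

text \<open>With \<open>\<epsilon>\<close> at most a quarter of the distance to the threshold, the choices are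
  \<open>x = \<epsilon> / 5 * ln N\<close>, about \<open>N powr (1 - \<epsilon>)\<close> marked vertices per class and edge
  probabilities below \<open>\<epsilon> / 2\<close>. Then about \<open>N powr (9 / 5 * \<epsilon>)\<close> flippable vertices outweigh
  the loss \<open>exp (4 * x) = N powr (4 / 5 * \<epsilon>)\<close> in a swap.\<close>

lemma hsbm_failure_prob_ge_powers:
  fixes \<epsilon> :: real and N :: nat
  defines "r \<equiv> real N"
  assumes model: "block_model L (\<lambda>l. edge_prob N q l (a l)) (\<lambda>l. edge_prob N q l (b l)) (\<epsilon> / 2)"
    and L: "\<And>l. l \<in> L \<Longrightarrow> l \<le> N" and q: "0 \<le> q"
    and N: "even N" "2 \<le> N"
    and est: "\<And>X. X \<subseteq> potential_edges L N \<Longrightarrow> est X \<in> {..<N} \<rightarrow> {-1, 1 :: int}"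
    and \<epsilon>: "0 < \<epsilon>" "\<epsilon> \<le> 1 / 8"
    and below: "D_GH L a b * q \<le> (1 - 4 * \<epsilon>) * ln r"
    and large: "256 * ln r \<le> (\<epsilon> / 5 * ln r)\<^sup>2" "2 * (r powr (1 - \<epsilon>) + 1) \<le> r"
      "1 < r powr (9 / 5 * \<epsilon>) / 8"
  shows "1 - (32 * r powr (- (9 / 5 * \<epsilon>))
      + 128 * (\<Sum>l\<in>L. real (l - 1) * 2 ^ (l - 1)) * ((r powr (1 - \<epsilon>) + 1) * ln r / (r - 1))
      + 16 * r powr (4 / 5 * \<epsilon>) / (r powr (9 / 5 * \<epsilon>) / 8 - 1))
    \<le> measure_pmf.prob (hsbm L N a b q) {(y, H). real N * mismatch_ratio N y (est H) \<ge> 2}"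
proof -
  interpret block_model N L "\<lambda>l. edge_prob N q l (a l)" "\<lambda>l. edge_prob N q l (b l)" "\<epsilon> / 2"
    by (rule model)
  define x where "x = \<epsilon> / 5 * ln r"
  define t where "t = nat \<lceil>r powr (1 - \<epsilon>)\<rceil>"
  define K where "K = (\<Sum>l\<in>L. real (l - 1) * 2 ^ (l - 1))"
  have r: "2 \<le> r" using N by (simp add: r_def)
  have lnr: "0 < ln r" using r by simp
  have x: "0 < x" using \<epsilon> lnr by (simp add: x_def)
  have sig: "signal \<le> (1 - 4 * \<epsilon>) * ln r" using below signal_eq_D_GH[OF model L q] by simp
  also have "\<dots> \<le> 1 * ln r" using \<epsilon> lnr by (intro mult_right_mono) auto
  finally have sig_ln: "signal \<le> ln r" by simp
  have t_bounds: "r powr (1 - \<epsilon>) \<le> t" "t \<le> r powr (1 - \<epsilon>) + 1"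
    using powr_gt_zero[of r "1 - \<epsilon>"] r by (auto simp: t_def)
  have t: "1 \<le> t" "2 * t \<le> N"
  proof -
    have "0 < real t" using t_bounds(1) powr_gt_zero[of r "1 - \<epsilon>"] r by linarith
    then show "1 \<le> t" by simp
    have "2 * real t \<le> r" using t_bounds(2) large(2) by simp
    then show "2 * t \<le> N" by (simp add: r_def)
  qed
  have fp: "r powr (- (1 - 3 * \<epsilon>) - \<epsilon> / 5) / 2 \<le> flip_prob x"
  proof -
    \<comment> \<open>Passing from \<open>1 - 4 * \<epsilon>\<close> to \<open>1 - 3 * \<epsilon>\<close> pays for the factor
      \<open>1 / (1 - \<epsilon> / 2)^2\<close> by which the exponent exceeds the signal.\<close>
    have "(1 - 4 * \<epsilon>) \<le> (1 - 3 * \<epsilon>) * (1 - \<epsilon> / 2)\<^sup>2"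
    proof -
      have "0 \<le> \<epsilon> * \<epsilon> * (13 / 4 - 3 / 4 * \<epsilon>)" using \<epsilon> by (intro mult_nonneg_nonneg) auto
      moreover have "(1 - 3 * \<epsilon>) * (1 - \<epsilon> / 2)\<^sup>2 - (1 - 4 * \<epsilon>) = \<epsilon> * \<epsilon> * (13 / 4 - 3 / 4 * \<epsilon>)"
        by (simp add: power2_eq_square field_simps)
      ultimately show ?thesis by linarith
    qed
    then have "signal \<le> ((1 - 3 * \<epsilon>) * (1 - \<epsilon> / 2)\<^sup>2) * ln r"
      using sig lnr by (meson mult_right_mono less_imp_le order_trans)
    then have "signal / (1 - \<epsilon> / 2)\<^sup>2 \<le> (1 - 3 * \<epsilon>) * ln r"
      using \<epsilon> by (simp add: pos_divide_le_eq mult_ac)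
    then have "exp ((- (1 - 3 * \<epsilon>) - \<epsilon> / 5) * ln r) \<le> exp (- (signal / (1 - \<epsilon> / 2)\<^sup>2) - x)"
      by (simp add: x_def algebra_simps)
    then show ?thesis using r by (simp add: flip_prob_def powr_def)
  qed
  have tfp: "r powr (9 / 5 * \<epsilon>) / 2 \<le> t * flip_prob x"
  proof -
    have "r powr (9 / 5 * \<epsilon>) / 2 = r powr (1 - \<epsilon>) * (r powr (- (1 - 3 * \<epsilon>) - \<epsilon> / 5) / 2)"
      by (simp add: powr_add[symmetric] algebra_simps)
    also have "\<dots> \<le> t * flip_prob x" using t_bounds fp by (intro mult_mono) auto
    finally show ?thesis .
  qed
  have pos: "0 < r powr (9 / 5 * \<epsilon>)" using r by simp
  have 1: "16 / (t * flip_prob x) \<le> 32 * r powr (- (9 / 5 * \<epsilon>))"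
  proof -
    have "16 / (t * flip_prob x) \<le> 16 / (r powr (9 / 5 * \<epsilon>) / 2)"
      using tfp pos t(1) flip_prob_pos[of x] by (intro divide_left_mono mult_pos_pos) auto
    then show ?thesis by (simp add: powr_minus field_simps)
  qed
  have 2: "128 * real t * pair_gap \<le> 128 * K * ((r powr (1 - \<epsilon>) + 1) * ln r / (r - 1))"
  proof -
    have K: "0 \<le> K" unfolding K_def by (intro sum_nonneg) auto
    have "(r - 1) * pair_gap \<le> K * signal"
      using pair_gap_le N by (simp add: K_def r_def of_nat_diff)
    also have "\<dots> \<le> K * ln r" using sig_ln K by (intro mult_left_mono)
    finally have "pair_gap \<le> K * ln r / (r - 1)" using r by (simp add: field_simps)
    then have "real t * pair_gap \<le> (r powr (1 - \<epsilon>) + 1) * (K * ln r / (r - 1))"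
      using t_bounds pair_gap_nonneg by (intro mult_mono) auto
    also have "\<dots> = K * ((r powr (1 - \<epsilon>) + 1) * ln r / (r - 1))" by simp
    finally show ?thesis by linarith
  qed
  have 3: "16 * exp (4 * x) / (t * flip_prob x / 4 - 1)
    \<le> 16 * r powr (4 / 5 * \<epsilon>) / (r powr (9 / 5 * \<epsilon>) / 8 - 1)"
    using tfp large(3) r by (intro frac_le) (auto simp: powr_def x_def)
  have "1 - (16 / (t * flip_prob x) + 128 * real t * pair_gap
    + 16 * exp (4 * x) / (t * flip_prob x / 4 - 1))
    \<le> measure_pmf.prob (hsbm L N a b q) {(y, H). real N * mismatch_ratio N y (est H) \<ge> 2}"
  proof (rule hsbm_failure_prob_ge[OF model N(1) _ est t x])
    show "256 * signal \<le> x\<^sup>2" using sig_ln large(1) by (simp add: x_def)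
    show "1 < real t * flip_prob x / 4" using tfp large(3) by simp
  qed (use N in auto)
  then show ?thesis using 1 2 3 unfolding K_def by linarith
qed

lemma eventually_even_at_top: "eventually P even_at_top \<longleftrightarrow> (\<forall>\<^sub>F N in at_top. even N \<longrightarrow> P N)"
  by (simp add: even_at_top_def eventually_inf_principal)

lemma failure_bound_tendsto:
  assumes "0 < (\<epsilon> :: real)" "\<epsilon> < 1"
  shows "((\<lambda>r::real. 1 - (32 * r powr (- (9 / 5 * \<epsilon>)) + 128 * K * ((r powr (1 - \<epsilon>)
    + 1) * ln r / (r - 1))
      + 16 * r powr (4 / 5 * \<epsilon>) / (r powr (9 / 5 * \<epsilon>) / 8 - 1))) \<longlongrightarrow> 1) at_top"
proof -
  have 1: "((\<lambda>r::real. r powr (- (9 / 5 * \<epsilon>))) \<longlongrightarrow> 0) at_top" using assms by real_asymp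
  have 2: "((\<lambda>r::real. (r powr (1 - \<epsilon>) + 1) * ln r / (r - 1)) \<longlongrightarrow> 0) at_top"
    using assms by real_asymp
  have 3: "((\<lambda>r::real. 16 * r powr (4 / 5 * \<epsilon>) / (r powr (9 / 5 * \<epsilon>) / 8 - 1)) \<longlongrightarrow> 0) at_top"
    using assms by real_asymp
  have "((\<lambda>r::real. 1 - (32 * r powr (- (9 / 5 * \<epsilon>)) + 128 * K * ((r powr (1 - \<epsilon>)
    + 1) * ln r / (r - 1))
      + 16 * r powr (4 / 5 * \<epsilon>) / (r powr (9 / 5 * \<epsilon>) / 8 - 1))) \<longlongrightarrow> 1 - (32 * 0 + 128 * K * 0
        + 0)) at_top"
    by (intro tendsto_intros 1 2 3)
  then show ?thesis by simp
qed

theorem theorem2p1: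
  fixes L :: "nat set"
    and a b :: "nat \<Rightarrow> nat \<Rightarrow> real"
    and q :: "nat \<Rightarrow> real"
    and yhat :: "nat \<Rightarrow> nat set set \<Rightarrow> (nat \<Rightarrow> int)"
  assumes L_finite: "finite L"
    and L_ge_2: "\<And>l. l \<in> L \<Longrightarrow> l \<ge> 2"
    and q_lower: "filterlim q at_top even_at_top"
    and q_upper: "q \<in> O[even_at_top](\<lambda>N. ln (real N))"
    and a_ge_b: "\<And>l. l \<in> L \<Longrightarrow> \<forall>\<^sub>F N in even_at_top. a N l \<ge> b N l"
    and b_lower: "\<And>l. l \<in> L \<Longrightarrow> \<exists>c>0. \<forall>\<^sub>F N in even_at_top. b N l \<ge> c"
    and sparse: "\<And>l. l \<in> L \<Longrightarrow> ((\<lambda>N. edge_prob N (q N) l (a N l)) \<longlongrightarrow> 0) even_at_top"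
    and below_threshold:
      "Limsup even_at_top (\<lambda>N. ereal (D_GH L (a N) (b N) * q N / ln (real N))) < 1"
    and estimator:
      "\<And>N H. even N \<Longrightarrow> H \<subseteq> potential_edges L N \<Longrightarrow> yhat N H \<in> {..<N} \<rightarrow> {-1, 1}"
  shows "((\<lambda>N. measure_pmf.prob (hsbm L N (a N) (b N) (q N))
             {(y, H). real N * mismatch_ratio N y (yhat N H) \<ge> 2}) \<longlongrightarrow> 1) even_at_top"
proof -
  obtain C where C: "Limsup even_at_top (\<lambda>N. ereal (D_GH L (a N) (b N)
    * q N / ln (real N))) < ereal C" "C < 1"
    using ereal_dense2[OF below_threshold]
      by (metis ereal_less(3) less_ereal.simps(1) one_ereal_def)
  define \<epsilon> where "\<epsilon> = min ((1 - C) / 4) (1 / 8)"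
  have \<epsilon>: "0 < \<epsilon>" "\<epsilon> \<le> 1 / 8" "C \<le> 1 - 4 * \<epsilon>" using C(2) by (auto simp: \<epsilon>_def min_def field_simps)
  have even_le: "even_at_top \<le> at_top" by (simp add: even_at_top_def)
  have large: "eventually P even_at_top" if "eventually (\<lambda>N. P N) at_top" for P
    using that even_le by (rule filter_leD[rotated])
  have large_real: "\<forall>\<^sub>F N in even_at_top. P (real N)" if "eventually P at_top" for P
    by (rule large) (use that filterlim_real_sequentially in \<open>auto simp: filterlim_iff\<close>)
  have ev_even: "\<forall>\<^sub>F N in even_at_top. even N" by (simp add: eventually_even_at_top)
  have ev_below: "\<forall>\<^sub>F N in even_at_top. D_GH L (a N) (b N) * q N / ln (real N) < C"
    using Limsup_lessD[OF C(1)] by simp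
  have ev_q: "\<forall>\<^sub>F N in even_at_top. 0 < q N"
    using q_lower by (simp add: filterlim_at_top_dense)
  have ev_L: "\<forall>\<^sub>F N in even_at_top. \<forall>l\<in>L. l \<le> N \<and> 0 < b N l \<and> b N l
    \<le> a N l \<and> edge_prob N (q N) l (a N l) \<le> \<epsilon> / 2"
  proof (rule eventually_ball_finite[OF L_finite], rule ballI)
    fix l assume l: "l \<in> L"
    obtain c where c: "0 < c" "\<forall>\<^sub>F N in even_at_top. c \<le> b N l" using b_lower[OF l] by auto
    have "\<forall>\<^sub>F N in even_at_top. edge_prob N (q N) l (a N l) < \<epsilon> / 2"
      using order_tendstoD(2)[OF sparse[OF l], of "\<epsilon> / 2"] \<epsilon> by simp
    then show "\<forall>\<^sub>F N in even_at_top. l \<le> N \<and> 0 < b N l \<and> b N l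
      \<le> a N l \<and> edge_prob N (q N) l (a N l) \<le> \<epsilon> / 2"
      using c(2) a_ge_b[OF l] large[OF eventually_ge_at_top[of l]]
      by eventually_elim (use c(1) in auto)
  qed
  have ev1: "\<forall>\<^sub>F r::real in at_top. 256 * ln r \<le> (\<epsilon> / 5 * ln r)\<^sup>2" using \<epsilon>(1) by real_asymp
  have "\<epsilon> < 1" using \<epsilon>(2) by simp
  then have ev2: "\<forall>\<^sub>F r::real in at_top. 2 * (r powr (1 - \<epsilon>) + 1) \<le> r" using \<epsilon>(1) by real_asymp
  have ev3: "\<forall>\<^sub>F r::real in at_top. 1 < r powr (9 / 5 * \<epsilon>) / 8" using \<epsilon>(1) by real_asymp
  let ?f = "\<lambda>r::real. 1 - (32 * r powr (- (9 / 5 * \<epsilon>))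
      + 128 * (\<Sum>l\<in>L. real (l - 1) * 2 ^ (l - 1)) * ((r powr (1 - \<epsilon>) + 1) * ln r / (r - 1))
      + 16 * r powr (4 / 5 * \<epsilon>) / (r powr (9 / 5 * \<epsilon>) / 8 - 1))"
  have lower: "\<forall>\<^sub>F N in even_at_top. ?f (real N) \<le> measure_pmf.prob (hsbm L N (a N) (b N) (q N))
             {(y, H). real N * mismatch_ratio N y (yhat N H) \<ge> 2}"
    using ev_even ev_below ev_q ev_L large[OF eventually_ge_at_top[of 2]]
      large_real[OF ev1] large_real[OF ev2] large_real[OF ev3]
  proof eventually_elim
    case (elim N)
    have model: "block_model L (\<lambda>l. edge_prob N (q N) l (a N l))
      (\<lambda>l. edge_prob N (q N) l (b N l)) (\<epsilon> / 2)"
    proof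
      fix l assume l: "l \<in> L"
      have "l - 1 \<le> N - 1" using elim l by (intro diff_le_mono) auto
      then have C: "0 < real ((N - 1) choose (l - 1))" by simp
      show "0 < edge_prob N (q N) l (b N l)" using elim l C by (simp add: edge_prob_def)
      show "edge_prob N (q N) l (b N l) \<le> edge_prob N (q N) l (a N l)"
        unfolding edge_prob_def using elim l by (intro divide_right_mono mult_right_mono) auto
    qed (use L_finite L_ge_2 elim \<epsilon> in auto)
    have "0 < ln (real N)" using elim by simp
    then have "D_GH L (a N) (b N) * q N < C * ln (real N)"
      using elim by (simp add: pos_divide_less_eq)
    also have "\<dots> \<le> (1 - 4 * \<epsilon>) * ln (real N)"
      using \<epsilon>(3) \<open>0 < ln (real N)\<close> by (intro mult_right_mono) auto
    finally show ?case
      using elim \<epsilon> estimator by (intro hsbm_failure_prob_ge_powers model) auto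
  qed
  have "((\<lambda>N. ?f (real N)) \<longlongrightarrow> 1) even_at_top"
    using \<epsilon> by (intro tendsto_mono[OF even_le]
      filterlim_compose[OF failure_bound_tendsto filterlim_real_sequentially]) auto
  then show ?thesis
    by (rule tendsto_sandwich[OF lower, rotated]) (auto simp: measure_pmf.prob_le_1)
qed

end
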